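(* Let $-\infty<A\le 0<B<\infty$, let $U$ be a compact metric space, and let $\mu:[A,B]\times U\to\mathbb R$, $\sigma:[A,B]\times U\to\mathbb R_{>0}$, $f:[A,B]\times U\to\mathbb R$ be Borel measurable. Assume that $\mu(x,\eta),\sigma(x,\eta),f(x,\eta)$ are continuous in $\eta$ and measurable in $x$, and that there exist positive Borel measurable functions $\Lambda,\varsigma,F$ on $[A,B]$ such that, for a.e. $x\in(A,B)$ and all $\eta\in U$, $$\Lambda(x)\ge \frac{|\mu(x,\eta)|}{\sigma^2(x,\eta)},\qquad F(x)\ge\frac{|f(x,\eta)|}{\sigma^2(x,\eta)},\qquad \varsigma(x)\le\sigma^2(x,\eta),$$ and $\Lambda,F,\frac1\varsigma\in L_1[A,B]$. Let $\nu_B$ be a probability distribution on $[A,B)$ and let $P_B\in\mathbb R$. Then there exist $\alpha\in\mathbb R$ and a function $V_\alpha\in W^{2,1}[A,B]$ such that $$\begin{cases}\alpha=\sup_{\eta\in U}\left(\frac12\sigma^2(x,\eta)V_\alpha''(x)+\mu(x,\eta)V_\alpha'(x)+f(x,\eta)\right) & \text{for a.e. }x\in(A,B),\\ V_\alpha(B)+P_B=\int_{[A,B)}V_\alpha(x)\,\mathrm d\nu_B(x),\\ V_\alpha'(A)=0.\end{cases}$$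
   Context: $W^{2,1}[A,B]$ is the space of functions on $[A,B]$ whose first derivative is absolutely continuous on $[A,B]$. (This is the Hamilton–Jacobi–Bellman equation with non-local boundary condition for a controlled diffusion with one reflecting boundary point $A$ and one resetting boundary point $B$, where $\nu_B$ is the reset distribution and $P_B$ the penalty.) *)

theory Defs
  imports "HOL-Probability.Probability"
begin

text \<open>
  Unlike \<open>deriv\<close>, this is the one-sided derivative at the endpoints, and it does not depend on
  the values of the function outside the interval.
\<close>

definition interval_deriv :: "real \<Rightarrow> real \<Rightarrow> (real \<Rightarrow> real) \<Rightarrow> real \<Rightarrow> real" where
  "interval_deriv a b f x = vector_derivative f (at x within {a..b})"

text \<open>
  Absolute continuity of functions; the constant \<^const>\<open>absolutely_continuous\<close> is the
  unrelated notion for measures.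
\<close>

definition abs_continuous_on_interval :: "real \<Rightarrow> real \<Rightarrow> (real \<Rightarrow> real) \<Rightarrow> bool" where
  "abs_continuous_on_interval a b g \<longleftrightarrow>
     (\<forall>\<epsilon>>0. \<exists>\<delta>>0. \<forall>(n::nat) (s::nat \<Rightarrow> real) (t::nat \<Rightarrow> real).
        (\<forall>i<n. a \<le> s i \<and> s i < t i \<and> t i \<le> b) \<longrightarrow>
        disjoint_family_on (\<lambda>i. {s i<..<t i}) {..<n} \<longrightarrow>
        (\<Sum>i<n. t i - s i) < \<delta> \<longrightarrow>
        (\<Sum>i<n. \<bar>g (t i) - g (s i)\<bar>) < \<epsilon>)"

definition W21 :: "real \<Rightarrow> real \<Rightarrow> (real \<Rightarrow> real) set" where
  "W21 a b = {V. V differentiable_on {a..b} \<and> abs_continuous_on_interval a b (interval_deriv a b V)}"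

end

theory Submission
  imports Defs
begin

text \<open>
  Since \<open>\<sigma>\<^sup>2 > 0\<close> and \<open>U\<close> is compact, the equation says that \<open>v = V'\<close> solves the first-order ODE
  \<open>v' = min\<^sub>\<eta> 2/\<sigma>\<^sup>2 (\<alpha> - \<mu> v - f)\<close>, \<open>v A = 0\<close>. Its right-hand side is measurable in \<open>x\<close> and Lipschitz
  in \<open>v\<close> with the integrable constant \<open>2 \<Lambda>\<close>, so Picard iteration in the norm weighted by
  \<open>exp (- 2 \<integral> 2 \<Lambda>)\<close> gives a solution \<open>v\<^sub>\<alpha>\<close> for every \<open>\<alpha>\<close>. For \<open>\<alpha> \<le> \<beta>\<close>, Gronwall estimates bound
  \<open>v\<^sub>\<beta> - v\<^sub>\<alpha>\<close> below by \<open>(\<beta> - \<alpha>) p\<close>, with \<open>p > 0\<close> on \<open>(A, B]\<close>, and above by \<open>(\<beta> - \<alpha>) C\<close>. As \<open>\<nu>\<^sub>B\<close>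
  does not charge \<open>B\<close>, the map \<open>\<alpha> \<mapsto> \<integral> (V\<^sub>\<alpha> B - V\<^sub>\<alpha> x) d\<nu>\<^sub>B\<close> is Lipschitz with slope bounded below by a
  positive constant; hence it takes the value \<open>- P\<^sub>B\<close>. Finally, \<open>v\<close> is an indefinite integral, so it is
  absolutely continuous and, by Lebesgue's differentiation theorem, satisfies the ODE pointwise a.e.
\<close>

section \<open>Lebesgue differentiation\<close>

text \<open>Split \<open>\<bar>k x\<bar>\<close> into its truncation at height \<open>n\<close> and
  the excess \<open>h n x\<close>. The excess has small integral over \<open>S\<close> by dominated
  convergence, and the truncation contributes at most \<open>n\<close> times the measure of
  \<open>T\<close>.\<close>

lemma absolute_continuity_of_integral:
  fixes k :: "real \<Rightarrow> real"
  assumes k: "k absolutely_integrable_on S" and S: "S \<in> sets lebesgue" and e: "e > 0"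
  obtains d where "d > 0"
    "\<And>T. T \<subseteq> S \<Longrightarrow> T \<in> lmeasurable \<Longrightarrow> measure lebesgue T < d \<Longrightarrow> integral T (\<lambda>x. \<bar>k x\<bar>) < e"
proof -
  have ak: "(\<lambda>x. \<bar>k x\<bar>) absolutely_integrable_on S"
    using absolutely_integrable_abs[OF k] by simp
  define h where "h n x = \<bar>k x\<bar> - min \<bar>k x\<bar> (real n)" for n :: nat and x
  have hint: "h n absolutely_integrable_on S" for n
  proof (rule measurable_bounded_by_integrable_imp_absolutely_integrable)
    show "(\<lambda>x. \<bar>k x\<bar>) integrable_on S" using ak absolutely_integrable_on_def by blast
    show "h n \<in> borel_measurable (lebesgue_on S)"
      using ak S unfolding h_def[abs_def]
      by (intro borel_measurable_diff borel_measurable_min borel_measurable_const)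
        (auto simp: absolutely_integrable_measurable)
  qed (use S in \<open>auto simp: h_def\<close>)
  have "(\<lambda>n. integral S (h n)) \<longlonglongrightarrow> integral S (\<lambda>x. 0)"
  proof (rule dominated_convergence(2))
    show "h n integrable_on S" for n using hint absolutely_integrable_on_def by blast
    show "(\<lambda>x. \<bar>k x\<bar>) integrable_on S" using ak absolutely_integrable_on_def by blast
    show "norm (h n x) \<le> \<bar>k x\<bar>" if "x \<in> S" for n x by (auto simp: h_def)
    show "(\<lambda>n. h n x) \<longlonglongrightarrow> 0" if "x \<in> S" for x
    proof (rule tendsto_eventually)
      obtain N where "\<bar>k x\<bar> \<le> real N" using real_arch_simple by blast
      then show "\<forall>\<^sub>F n in sequentially. h n x = 0"
        by (auto simp: h_def eventually_sequentially intro!: exI[of _ N])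
    qed
  qed
  then obtain n where n: "integral S (h n) < e/2"
    using e order_tendstoD(2)[of "\<lambda>n. integral S (h n)" 0 sequentially "e/2"]
    by (auto simp: eventually_sequentially)
  show ?thesis
  proof (rule that)
    \<comment> \<open>Chosen so that the truncated part contributes at most \<open>e/2\<close>; the
      \<open>+ 1\<close> covers the case \<open>n = 0\<close>.\<close>
    show "e / (2 * (real n + 1)) > 0" using e by simp
    fix T assume T: "T \<subseteq> S" "T \<in> lmeasurable" "measure lebesgue T < e / (2 * (real n + 1))"
    have akT: "(\<lambda>x. \<bar>k x\<bar>) absolutely_integrable_on T" and hT: "h n absolutely_integrable_on T"
      using T ak hint by (auto intro: set_integrable_subset dest: fmeasurableD)
    have c: "(\<lambda>x. real n) integrable_on T"
      using T(2) integrable_on_const by blast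
    have "integral T (\<lambda>x. \<bar>k x\<bar>) \<le> integral T (\<lambda>x. h n x + real n)"
      using akT hT c by (intro integral_le integrable_add) (auto simp: h_def absolutely_integrable_on_def)
    also have "\<dots> = integral T (h n) + integral T (\<lambda>x. real n)"
      using hT c by (intro Henstock_Kurzweil_Integration.integral_add) (auto simp: absolutely_integrable_on_def)
    also have "integral T (h n) \<le> integral S (h n)"
      using T hint hT by (intro integral_subset_le) (auto simp: h_def absolutely_integrable_on_def)
    also have "integral T (\<lambda>x. real n) = real n * measure lebesgue T"
      using T(2) by (simp add: lmeasure_integral flip: integral_mult_right)
    also have "real n * measure lebesgue T \<le> real n * (e / (2 * (real n + 1)))"
      using T(3) by (intro mult_left_mono) auto
    also have "\<dots> \<le> e/2" using e by (simp add: field_simps)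
    finally show "integral T (\<lambda>x. \<bar>k x\<bar>) < e" using n by linarith
  qed
qed

text \<open>Vitali covering argument. As \<open>k\<close> vanishes on \<open>E\<close>, its integral
  over a close open superset \<open>G\<close> of \<open>E\<close> is small. The intervals inside
  \<open>G\<close> on which the average of \<open>k\<close> exceeds \<open>c\<close> form a Vitali
  cover, and a disjoint subfamily has total length at most \<open>1/c\<close> times that
  integral.\<close>

lemma negligible_large_averages:
  fixes k :: "real \<Rightarrow> real"
  assumes k: "k absolutely_integrable_on {a..b}" and k0: "\<And>x. 0 \<le> k x"
    and E: "E \<in> sets lebesgue" and kE: "\<And>x. x \<in> E \<Longrightarrow> k x = 0" and c: "c > 0"
  shows "negligible {x \<in> E. \<forall>d>0. \<exists>u v. a \<le> u \<and> u \<le> x \<and> x \<le> v \<and> v \<le> b \<and> u < v \<and> v - u < d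
           \<and> c * (v - u) < integral {u..v} k}" (is "negligible ?S")
  unfolding negligible_outer_le
proof (intro allI impI)
  fix e :: real assume e: "e > 0"
  obtain d where d: "d > 0" "\<And>T. T \<subseteq> {a..b} \<Longrightarrow> T \<in> lmeasurable \<Longrightarrow> measure lebesgue T < d
      \<Longrightarrow> integral T (\<lambda>x. \<bar>k x\<bar>) < e * c"
    using absolute_continuity_of_integral[OF k, of "e * c"] e c by auto
  obtain G where G: "open G" "E \<subseteq> G" "G - E \<in> lmeasurable" "emeasure lebesgue (G - E) < ennreal d"
    using sets_lebesgue_outer_open[OF E d(1)] by auto
  let ?T = "{a..b} \<inter> (G - E)"
  have T: "?T \<in> lmeasurable" using G(3) by (simp add: fmeasurable.Int)
  have "measure lebesgue (G - E) < d"
    using G(3,4) d(1) by (simp add: emeasure_eq_measure2 ennreal_less_iff)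
  then have "measure lebesgue ?T < d"
    using measure_mono_fmeasurable[of ?T "G - E" lebesgue] G(3) T by (auto dest: fmeasurableD)
  then have Tk: "integral ?T k < e * c" using d(2)[of ?T] T k0 by simp
  have GE: "integral ({a..b} \<inter> G) k = integral ?T k"
    by (rule integral_spike_set) (auto intro: negligible_subset[of "{}"] simp: kE)
  \<comment> \<open>Intervals are indexed by their endpoints; \<open>?m\<close> and
    \<open>?r\<close> recast them as closed balls, the form in which the covering theorem takes
    them.\<close>
  define K where "K = {(u,v). a \<le> u \<and> u < v \<and> v \<le> b \<and> {u..v} \<subseteq> G \<and> c * (v - u) < integral {u..v} k}"
  let ?m = "\<lambda>i::real\<times>real. (fst i + snd i) / 2" and ?r = "\<lambda>i::real\<times>real. (snd i - fst i) / 2"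
  have cb: "cball (?m i) (?r i) = {fst i..snd i}" for i
    by (auto simp: cball_eq_atLeastAtMost field_simps)
  obtain C where C: "countable C" "C \<subseteq> K"
     "pairwise (\<lambda>i j. disjnt (cball (?m i) (?r i)) (cball (?m j) (?r j))) C"
     "negligible(?S - (\<Union>i \<in> C. cball (?m i) (?r i)))"
  proof (rule Vitali_covering_theorem_cballs[of K ?r ?S ?m])
    show "0 < ?r i" if "i \<in> K" for i using that by (auto simp: K_def)
    fix x d :: real assume x: "x \<in> ?S" "0 < d"
    then have "x \<in> G" using G by auto
    then obtain r where r: "r > 0" "ball x r \<subseteq> G" using G(1) openE by blast
    have "min r d > 0" using r x by auto
    then obtain u v where uv: "a \<le> u" "u \<le> x" "x \<le> v" "v \<le> b" "u < v" "v - u < min r d"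
      "c * (v - u) < integral {u..v} k" using x(1) by blast
    have "{u..v} \<subseteq> ball x r" using uv by (auto simp: dist_real_def)
    then have "(u,v) \<in> K" using uv r by (auto simp: K_def)
    then show "\<exists>i. i \<in> K \<and> x \<in> cball (?m i) (?r i) \<and> ?r i < d"
      unfolding cb using uv by (intro exI[of _ "(u,v)"]) auto
  qed
  \<comment> \<open>Disjointness turns the sum of the integrals into one integral over a subset of
    \<open>G\<close>, so \<open>c\<close> times the total length stays below \<open>e * c\<close>.
    The bound is uniform in \<open>F\<close> and hence passes to the countable family
    \<open>C\<close>.\<close>
  have fin: "measure lebesgue (\<Union>i\<in>F. {fst i..snd i}) \<le> e" if F: "F \<subseteq> C" "finite F" for F
  proof -
    have dis: "pairwise (\<lambda>i j. negligible ({fst i..snd i} \<inter> {fst j..snd j})) F"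
      using pairwise_subset[OF C(3) F(1)] unfolding cb by (auto simp: pairwise_def disjnt_def)
    have ki: "k integrable_on {fst i..snd i}" if "i \<in> F" for i
      using that F C(2) k by (auto simp: K_def intro!: integrable_on_subinterval[of k "{a..b}"]
          simp: absolutely_integrable_on_def)
    have hU: "(k has_integral (\<Sum>i\<in>F. integral {fst i..snd i} k)) (\<Union>i\<in>F. {fst i..snd i})"
      using has_integral_UN[of F k "\<lambda>i. integral {fst i..snd i} k" "\<lambda>i. {fst i..snd i}"] F ki dis
      by (auto simp: integrable_integral)
    have "c * measure lebesgue (\<Union>i\<in>F. {fst i..snd i}) \<le> c * (\<Sum>i\<in>F. measure lebesgue {fst i..snd i})"
      using F c by (intro mult_left_mono measure_UNION_le) auto
    also have "\<dots> = (\<Sum>i\<in>F. c * (snd i - fst i))"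
      unfolding sum_distrib_left using F C(2) by (intro sum.cong) (auto simp: K_def)
    also have "\<dots> \<le> (\<Sum>i\<in>F. integral {fst i..snd i} k)"
      using F C(2) by (intro sum_mono) (auto simp: K_def less_imp_le)
    also have "\<dots> = integral (\<Union>i\<in>F. {fst i..snd i}) k" using integral_unique[OF hU] by simp
    also have "\<dots> \<le> integral ({a..b} \<inter> G) k"
    proof (rule integral_subset_le)
      show "(\<Union>i\<in>F. {fst i..snd i}) \<subseteq> {a..b} \<inter> G" using F C(2) by (fastforce simp: K_def)
      show "k integrable_on {a..b} \<inter> G"
        using set_integrable_subset[OF k, of "{a..b} \<inter> G"] G(1)
        by (auto simp: absolutely_integrable_on_def)
    qed (use hU k0 in auto)
    also have "\<dots> < e * c" using GE Tk by simp
    finally show ?thesis using c by (simp add: mult.commute)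
  qed
  let ?W = "\<Union>i\<in>C. {fst i..snd i}"
  have W: "?W \<in> lmeasurable" "measure lebesgue ?W \<le> e"
    using fmeasurable_UN_bound[of C "\<lambda>i. {fst i..snd i}" lebesgue e]
      measure_UN_bound[of C "\<lambda>i. {fst i..snd i}" lebesgue e] C(1) fin by auto
  have ng: "negligible (?S - ?W)" using C(4) unfolding cb .
  have "(?S - ?W) \<union> ?W \<in> lmeasurable"
    using fmeasurable.Un[OF negligible_imp_measurable[OF ng] W(1)] .
  moreover have "measure lebesgue ((?S - ?W) \<union> ?W) = measure lebesgue ?W"
    using measure_Un_null_set[of ?W lebesgue "?S - ?W"] ng W(1)
    by (simp only: Un_commute fmeasurableD negligible_iff_null_sets)
  ultimately show "\<exists>T. ?S \<subseteq> T \<and> T \<in> lmeasurable \<and> measure lebesgue T \<le> e"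
    using W(2) by (intro exI[of _ "(?S - ?W) \<union> ?W"]) auto
qed

text \<open>Applies the previous lemma to \<open>max (g - p) 0\<close> on \<open>{g \<le> p}\<close> for every rational \<open>p\<close>.\<close>

lemma averages_eventually_le:
  fixes g :: "real \<Rightarrow> real"
  assumes g: "g absolutely_integrable_on {a..b}"
  obtains N where "negligible N" "\<And>x e. x \<in> {a..b} - N \<Longrightarrow> e > 0 \<Longrightarrow> \<exists>d>0. \<forall>u v. a \<le> u \<longrightarrow> u \<le> x \<longrightarrow> x \<le> v
     \<longrightarrow> v \<le> b \<longrightarrow> u < v \<longrightarrow> v - u < d \<longrightarrow> integral {u..v} g \<le> (g x + e) * (v - u)"
proof -
  define k where "k p x = (if x \<in> {a..b} then max (g x - p) 0 else 0)" for p x :: real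
  define E where "E p = {x\<in>{a..b}. g x \<le> p}" for p
  define S where "S p c = {x \<in> E p. \<forall>d>0. \<exists>u v. a \<le> u \<and> u \<le> x \<and> x \<le> v \<and> v \<le> b \<and> u < v \<and> v - u < d
           \<and> c * (v - u) < integral {u..v} (k p)}" for p c
  have gm: "g \<in> borel_measurable (lebesgue_on {a..b})"
    using g by (simp add: absolutely_integrable_measurable)
  have kint: "k p absolutely_integrable_on {a..b}" for p
  proof -
    have "(\<lambda>x. max (g x - p) 0) absolutely_integrable_on {a..b}"
      using g by (intro absolutely_integrable_max_1 set_integral_diff absolutely_integrable_on_const) auto
    then show ?thesis by (rule absolutely_integrable_spike[where S = "{}"]) (auto simp: k_def)
  qed
  have Em: "E p \<in> sets lebesgue" for p
  proof -
    have "{x \<in> space (lebesgue_on {a..b}). g x \<le> p} \<in> sets (lebesgue_on {a..b})"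
      using gm by measurable
    then show ?thesis by (simp add: E_def sets_restrict_space_iff)
  qed
  have neg: "negligible (S p c)" if "c > 0" for p c
    unfolding S_def by (rule negligible_large_averages[OF kint _ Em _ that]) (auto simp: k_def E_def)
  show ?thesis
  proof (rule that)
    show "negligible (\<Union>p\<in>\<rat>. \<Union>n. S p (1 / real (Suc n)))"
      by (intro negligible_countable_Union countable_image countable_rat) (auto intro!: negligible_countable_Union neg)
    fix x e :: real
    assume x: "x \<in> {a..b} - (\<Union>p\<in>\<rat>. \<Union>n. S p (1 / real (Suc n)))" and e: "e > 0"
    \<comment> \<open>Rational levels \<open>p\<close> and thresholds
      \<open>1 / real (Suc n)\<close> leave only countably many exceptional sets. One half of
      \<open>e\<close> is spent on the gap between \<open>g x\<close> and \<open>p\<close>, the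
      other on the average of \<open>k p\<close>.\<close>
    obtain p where p: "p \<in> \<rat>" "g x < p" "p < g x + e/2"
      using Rats_dense_in_real[of "g x" "g x + e/2"] e by auto
    obtain n where n: "1 / real (Suc n) < e/2" using e nat_approx_posE[of "e/2"] by auto
    have "x \<notin> S p (1 / real (Suc n))" "x \<in> E p" using x p by (auto simp: E_def)
    then obtain d where d: "d > 0" "\<And>u v. a \<le> u \<Longrightarrow> u \<le> x \<Longrightarrow> x \<le> v \<Longrightarrow> v \<le> b \<Longrightarrow> u < v \<Longrightarrow> v - u < d
           \<Longrightarrow> integral {u..v} (k p) \<le> (1 / real (Suc n)) * (v - u)"
      unfolding S_def mem_Collect_eq by (meson not_less)
    show "\<exists>d>0. \<forall>u v. a \<le> u \<longrightarrow> u \<le> x \<longrightarrow> x \<le> v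
     \<longrightarrow> v \<le> b \<longrightarrow> u < v \<longrightarrow> v - u < d \<longrightarrow> integral {u..v} g \<le> (g x + e) * (v - u)"
    proof (intro exI[of _ d] conjI d allI impI)
      fix u v assume uv: "a \<le> u" "u \<le> x" "x \<le> v" "v \<le> b" "u < v" "v - u < d"
      have ki: "k p integrable_on {u..v}" and gi: "g integrable_on {u..v}"
        using uv kint g integrable_on_subinterval[of _ "{a..b}" u v]
        by (auto simp: absolutely_integrable_on_def)
      have "integral {u..v} g \<le> integral {u..v} (\<lambda>x. k p x + p)"
      proof (intro integral_le integrable_add)
        show "g t \<le> k p t + p" if "t \<in> {u..v}" for t using that uv by (auto simp: k_def)
      qed (use ki gi in auto)
      also have "\<dots> = integral {u..v} (k p) + p * (v - u)"
        using ki uv by (subst Henstock_Kurzweil_Integration.integral_add) auto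
      also have "\<dots> \<le> e/2 * (v - u) + (g x + e/2) * (v - u)"
        using d(2)[OF uv] n p uv by (intro add_mono order.trans[OF d(2)[OF uv]] mult_right_mono) auto
      finally show "integral {u..v} g \<le> (g x + e) * (v - u)" by (simp add: algebra_simps)
    qed
  qed
qed

text \<open>Difference quotients are averages over intervals with \<open>x\<close> as an endpoint.
  The one-sided estimate for \<open>g\<close> bounds them from above, and the same estimate for
  \<open>- g\<close> bounds them from below.\<close>

lemma indefinite_integral_has_derivative_ae:
  fixes g :: "real \<Rightarrow> real"
  assumes g: "g absolutely_integrable_on {a..b}"
  obtains N where "negligible N"
    "\<And>x. x \<in> {a<..<b} - N \<Longrightarrow> ((\<lambda>x. integral {a..x} g) has_real_derivative g x) (at x)"
proof -
  obtain N1 where N1: "negligible N1" "\<And>x e. x \<in> {a..b} - N1 \<Longrightarrow> e > 0 \<Longrightarrow> \<exists>d>0. \<forall>u v. a \<le> u \<longrightarrow> u \<le> x \<longrightarrow> x \<le> v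
     \<longrightarrow> v \<le> b \<longrightarrow> u < v \<longrightarrow> v - u < d \<longrightarrow> integral {u..v} g \<le> (g x + e) * (v - u)"
    using averages_eventually_le[OF g] by blast
  have "(\<lambda>x. - g x) absolutely_integrable_on {a..b}"
    using g by (auto simp: absolutely_integrable_on_def intro: integrable_neg)
  from averages_eventually_le[OF this]
  obtain N2 where N2: "negligible N2" "\<And>x e. x \<in> {a..b} - N2 \<Longrightarrow> e > 0 \<Longrightarrow> \<exists>d>0. \<forall>u v. a \<le> u \<longrightarrow> u \<le> x \<longrightarrow> x \<le> v
     \<longrightarrow> v \<le> b \<longrightarrow> u < v \<longrightarrow> v - u < d \<longrightarrow> integral {u..v} (\<lambda>x. - g x) \<le> (- g x + e) * (v - u)"
    by blast
  show ?thesis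
  proof (rule that)
    show "negligible (N1 \<union> N2)" using N1 N2 by simp
    fix x assume x: "x \<in> {a<..<b} - (N1 \<union> N2)"
    have gi: "g integrable_on {u..v}" if "a \<le> u" "v \<le> b" for u v
      using that g by (auto simp: absolutely_integrable_on_def intro: integrable_on_subinterval)
    let ?I = "\<lambda>x. integral {a..x} g"
    show "(?I has_real_derivative g x) (at x)"
      unfolding has_field_derivative_iff LIM_def
    proof (intro allI impI)
      fix e :: real assume e: "e > 0"
      then have e2: "e/2 > 0" by simp
      have xx: "x \<in> {a..b} - N1" "x \<in> {a..b} - N2" using x by auto
      obtain d1 where d1: "d1 > 0" "\<And>u v. a \<le> u \<Longrightarrow> u \<le> x \<Longrightarrow> x \<le> v
         \<Longrightarrow> v \<le> b \<Longrightarrow> u < v \<Longrightarrow> v - u < d1 \<Longrightarrow> integral {u..v} g \<le> (g x + e/2) * (v - u)"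
        using N1(2)[OF xx(1) e2] by blast
      obtain d2 where d2: "d2 > 0" "\<And>u v. a \<le> u \<Longrightarrow> u \<le> x \<Longrightarrow> x \<le> v
         \<Longrightarrow> v \<le> b \<Longrightarrow> u < v \<Longrightarrow> v - u < d2 \<Longrightarrow> - integral {u..v} g \<le> (- g x + e/2) * (v - u)"
        using N2(2)[OF xx(2) e2] by (auto simp del: mult_minus_left)
      have main: "\<bar>(?I v - ?I u) / (v - u) - g x\<bar> < e"
        if uv: "a \<le> u" "u \<le> x" "x \<le> v" "v \<le> b" "u < v" "v - u < min d1 d2" for u v
      proof -
        have I: "?I v - ?I u = integral {u..v} g"
          using Henstock_Kurzweil_Integration.integral_combine[of a u v g] uv gi by auto
        have "integral {u..v} g / (v - u) \<le> g x + e/2"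
          using d1(2)[of u v] uv by (simp add: divide_le_eq)
        moreover have "g x - e/2 \<le> integral {u..v} g / (v - u)"
          using d2(2)[of u v] uv by (simp add: le_divide_eq algebra_simps)
        ultimately show ?thesis unfolding I using e by linarith
      qed
      show "\<exists>s>0. \<forall>y. y \<noteq> x \<and> dist y x < s \<longrightarrow> dist ((?I y - ?I x) / (y - x)) (g x) < e"
      \<comment> \<open>The distances to \<open>a\<close> and \<open>b\<close> enter the radius so
        that the interval between \<open>x\<close> and \<open>y\<close> stays inside
        \<open>{a..b}\<close>.\<close>
      proof (intro exI[of _ "min (min d1 d2) (min (x - a) (b - x))"] conjI allI impI)
        show "0 < min (min d1 d2) (min (x - a) (b - x))" using d1 d2 x by auto
        fix y assume y: "y \<noteq> x \<and> dist y x < min (min d1 d2) (min (x - a) (b - x))"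
        show "dist ((?I y - ?I x) / (y - x)) (g x) < e"
        proof (cases "x < y")
          case True then show ?thesis using main[of x y] y x by (auto simp: dist_real_def)
        next
          case False
          then have "\<bar>(?I x - ?I y) / (x - y) - g x\<bar> < e" using main[of y x] y x by (auto simp: dist_real_def)
          then show ?thesis by (metis minus_diff_eq minus_divide_divide dist_real_def)
        qed
      qed
    qed
  qed
qed

section \<open>Calculus of indefinite integrals\<close>

text \<open>The increments are dominated by the integral of \<open>\<bar>g x\<bar>\<close> over the
  union of the intervals, which is small once that union has small measure.\<close>

lemma abs_continuous_on_interval_integral:
  fixes g :: "real \<Rightarrow> real"
  assumes g: "g absolutely_integrable_on {a..b}"
    and w: "\<And>x. x \<in> {a..b} \<Longrightarrow> w x = c + integral {a..x} g"
  shows "abs_continuous_on_interval a b w"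
  unfolding abs_continuous_on_interval_def
proof (intro allI impI)
  fix e :: real assume e: "e > 0"
  obtain d where d: "d > 0" "\<And>T. T \<subseteq> {a..b} \<Longrightarrow> T \<in> lmeasurable \<Longrightarrow> measure lebesgue T < d
      \<Longrightarrow> integral T (\<lambda>x. \<bar>g x\<bar>) < e"
    using absolute_continuity_of_integral[OF g _ e] by auto
  have sub: "g integrable_on {u..v}" "(\<lambda>x. \<bar>g x\<bar>) integrable_on {u..v}" if "a \<le> u" "v \<le> b" for u v
    using that g integrable_on_subinterval[of _ "{a..b}" u v] by (auto simp: absolutely_integrable_on_def)
  show "\<exists>d>0. \<forall>(n::nat) s t. (\<forall>i<n. a \<le> s i \<and> s i < t i \<and> t i \<le> b) \<longrightarrow>
        disjoint_family_on (\<lambda>i. {s i<..<t i}) {..<n} \<longrightarrow>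
        (\<Sum>i<n. t i - s i) < d \<longrightarrow> (\<Sum>i<n. \<bar>w (t i) - w (s i)\<bar>) < e"
  proof (intro exI[of _ d] conjI d allI impI)
    fix n :: nat and s t :: "nat \<Rightarrow> real"
    assume st: "\<forall>i<n. a \<le> s i \<and> s i < t i \<and> t i \<le> b"
      and dis: "disjoint_family_on (\<lambda>i. {s i<..<t i}) {..<n}"
      and len: "(\<Sum>i<n. t i - s i) < d"
    let ?T = "\<Union>i<n. {s i<..<t i}"
    \<comment> \<open>Open and closed intervals carry the same integral, and the open ones are
      disjoint, so the contributions add up to a single integral over \<open>?T\<close>.\<close>
    have gi: "((\<lambda>x. \<bar>g x\<bar>) has_integral integral {s i..t i} (\<lambda>x. \<bar>g x\<bar>)) {s i<..<t i}" if "i < n" for i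
      using sub(2)[of "s i" "t i"] st that
      by (simp add: has_integral_open_interval[of _ _ "s i" "t i", unfolded box_real] integrable_integral)
    have hU: "((\<lambda>x. \<bar>g x\<bar>) has_integral (\<Sum>i<n. integral {s i..t i} (\<lambda>x. \<bar>g x\<bar>))) ?T"
      using dis by (intro has_integral_UN gi) (auto simp: pairwise_def disjoint_family_on_def)
    have "measure lebesgue ?T \<le> (\<Sum>i<n. measure lebesgue {s i<..<t i})"
      by (intro measure_UNION_le) auto
    also have "\<dots> = (\<Sum>i<n. t i - s i)" using st by (intro sum.cong) (auto simp: less_imp_le)
    finally have mT: "measure lebesgue ?T < d" using len by linarith
    have "?T \<subseteq> {a..b}"
    proof
      fix x assume "x \<in> ?T"
      then obtain i where "i < n" "s i < x" "x < t i" by auto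
      then show "x \<in> {a..b}" using st by force
    qed
    then have "integral ?T (\<lambda>x. \<bar>g x\<bar>) < e"
      using mT by (intro d) (auto intro!: fmeasurable.finite_UN)
    moreover have "\<bar>w (t i) - w (s i)\<bar> \<le> integral {s i..t i} (\<lambda>x. \<bar>g x\<bar>)" if "i < n" for i
    proof -
      have *: "a \<le> s i" "s i < t i" "t i \<le> b" using st that by auto
      then have "w (t i) - w (s i) = integral {s i..t i} g"
        using w[of "s i"] w[of "t i"] sub(1)[of a "t i"]
          Henstock_Kurzweil_Integration.integral_combine[of a "s i" "t i" g] by auto
      then show ?thesis
        using integral_norm_bound_integral[of g "{s i..t i}" "\<lambda>x. \<bar>g x\<bar>"] sub[of "s i" "t i"] * by auto
    qed
    then have "(\<Sum>i<n. \<bar>w (t i) - w (s i)\<bar>) \<le> (\<Sum>i<n. integral {s i..t i} (\<lambda>x. \<bar>g x\<bar>))"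
      by (intro sum_mono) auto
    ultimately show "(\<Sum>i<n. \<bar>w (t i) - w (s i)\<bar>) < e" using integral_unique[OF hU] by linarith
  qed
qed

section \<open>Product and chain rules for indefinite integrals\<close>

lemma absolutely_integrable_mult_continuous:
  fixes f g :: "real \<Rightarrow> real"
  assumes "f absolutely_integrable_on {a..b}" "continuous_on {a..b} g"
  shows "(\<lambda>x. f x * g x) absolutely_integrable_on {a..b}" "(\<lambda>x. g x * f x) absolutely_integrable_on {a..b}"
proof -
  show "(\<lambda>x. g x * f x) absolutely_integrable_on {a..b}"
    using assms by (intro absolutely_integrable_bounded_measurable_product_real)
      (auto simp: continuous_imp_measurable_on_sets_lebesgue compact_imp_bounded compact_continuous_image)
  then show "(\<lambda>x. f x * g x) absolutely_integrable_on {a..b}" by (simp add: mult.commute)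
qed

lemma integral_sub_eq:
  fixes g :: "real \<Rightarrow> real"
  assumes "g integrable_on {a..b}" "a \<le> u" "u \<le> v" "v \<le> b"
  shows "integral {a..v} g - integral {a..u} g = integral {u..v} g"
  using Henstock_Kurzweil_Integration.integral_combine[of a u v g]
    integrable_on_subinterval[OF assms(1), of a v] assms by auto

text \<open>Bisection turns a local error of \<open>e\<close> times an additive quantity into the same global error.\<close>

lemma eq_integral_if_local_error_small:
  fixes p g l :: "real \<Rightarrow> real"
  assumes ab: "a \<le> b" and g: "g integrable_on {a..b}"
    and l: "l integrable_on {a..b}" "\<And>x. x \<in> {a..b} \<Longrightarrow> l x \<ge> 0"
    and loc: "\<And>e. e > 0 \<Longrightarrow> \<exists>d>0. \<forall>u v. a \<le> u \<longrightarrow> u \<le> v \<longrightarrow> v \<le> b \<longrightarrow> v - u < d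
      \<longrightarrow> \<bar>p v - p u - integral {u..v} g\<bar> \<le> e * integral {u..v} l"
  shows "p b - p a = integral {a..b} g"
proof -
  have *: "\<bar>p b - p a - integral {a..b} g\<bar> \<le> e * integral {a..b} l" if e: "e > 0" for e
  proof -
    obtain d where d: "d > 0" "\<And>u v. a \<le> u \<Longrightarrow> u \<le> v \<Longrightarrow> v \<le> b \<Longrightarrow> v - u < d
      \<Longrightarrow> \<bar>p v - p u - integral {u..v} g\<bar> \<le> e * integral {u..v} l"
      using loc[OF e] by blast
    define Q where "Q u v \<longleftrightarrow> (a \<le> u \<and> u \<le> v \<and> v \<le> b \<longrightarrow>
       \<bar>p v - p u - integral {u..v} g\<bar> \<le> e * integral {u..v} l)" for u v
    have "Q a b" using ab
    proof (induct rule: Bolzano)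
      case (trans u v w)
      show ?case unfolding Q_def
      proof
        assume uw: "a \<le> u \<and> u \<le> w \<and> w \<le> b"
        then have "integral {u..w} g = integral {u..v} g + integral {v..w} g"
          "integral {u..w} l = integral {u..v} l + integral {v..w} l"
          using trans(3,4) g l integrable_on_subinterval[of _ "{a..b}" u w]
            Henstock_Kurzweil_Integration.integral_combine[of u v w] by fastforce+
        moreover have "\<bar>p v - p u - integral {u..v} g\<bar> \<le> e * integral {u..v} l"
          "\<bar>p w - p v - integral {v..w} g\<bar> \<le> e * integral {v..w} l"
          using trans uw by (auto simp: Q_def)
        ultimately show "\<bar>p w - p u - integral {u..w} g\<bar> \<le> e * integral {u..w} l"
          by (simp only: distrib_left)
      qed
    next
      case (local x)
      show ?case using d by (intro exI[of _ d]) (auto simp: Q_def)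
    qed
    then show ?thesis using ab by (simp add: Q_def)
  qed
  have L: "integral {a..b} l \<ge> 0" using l by (intro Henstock_Kurzweil_Integration.integral_nonneg) auto
  have "\<bar>p b - p a - integral {a..b} g\<bar> \<le> 0 + e" if "e > 0" for e
  proof -
    \<comment> \<open>Dividing by the total mass of \<open>l\<close> brings the global error below
      \<open>e\<close>; the \<open>+ 1\<close> keeps the denominator positive when \<open>l\<close>
      integrates to \<open>0\<close>.\<close>
    have "\<bar>p b - p a - integral {a..b} g\<bar> \<le> (e / (integral {a..b} l + 1)) * integral {a..b} l"
      using L that by (intro *) auto
    also have "\<dots> \<le> e" using L that by (simp add: field_simps)
    finally show ?thesis by simp
  qed
  then show ?thesis using field_le_epsilon[of "\<bar>p b - p a - integral {a..b} g\<bar>" 0] by auto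
qed

lemma continuous_on_indefinite_integral:
  fixes g :: "real \<Rightarrow> real"
  assumes "g integrable_on {a..b}" shows "continuous_on {a..b} (\<lambda>x. integral {a..x} g)"
  using indefinite_integral_continuous_1[OF assms] .

text \<open>The local estimate behind the product and exponential rules: freezing the weight
  \<open>q\<close> at a constant \<open>c\<close> costs at most its deviation \<open>e\<close> times
  the mass of \<open>h\<close>.\<close>

lemma integral_weighted_oscillation:
  fixes h q :: "real \<Rightarrow> real"
  assumes h: "h absolutely_integrable_on {u..v}" and q: "continuous_on {u..v} q"
    and c: "\<And>t. t \<in> {u..v} \<Longrightarrow> \<bar>c - q t\<bar> \<le> e"
  shows "\<bar>c * integral {u..v} h - integral {u..v} (\<lambda>t. h t * q t)\<bar> \<le> e * integral {u..v} (\<lambda>t. \<bar>h t\<bar>)"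
proof -
  have i: "h integrable_on {u..v}" "(\<lambda>t. \<bar>h t\<bar>) integrable_on {u..v}"
    "(\<lambda>t. h t * q t) integrable_on {u..v}"
    using h absolutely_integrable_mult_continuous(1)[OF h q] by (auto simp: absolutely_integrable_on_def)
  have "c * integral {u..v} h - integral {u..v} (\<lambda>t. h t * q t) = integral {u..v} (\<lambda>t. c * h t - h t * q t)"
    using i by (subst Henstock_Kurzweil_Integration.integral_diff) (auto intro: integrable_on_mult_right)
  also have "\<bar>\<dots>\<bar> \<le> integral {u..v} (\<lambda>t. e * \<bar>h t\<bar>)"
  proof -
    have "\<bar>c * h t - h t * q t\<bar> \<le> e * \<bar>h t\<bar>" if "t \<in> {u..v}" for t
    proof -
      have "\<bar>c * h t - h t * q t\<bar> = \<bar>c - q t\<bar> * \<bar>h t\<bar>" by (simp add: algebra_simps flip: abs_mult)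
      then show ?thesis using c[OF that] by (simp add: mult_right_mono)
    qed
    moreover have "(\<lambda>t. c * h t - h t * q t) integrable_on {u..v}" "(\<lambda>t. e * \<bar>h t\<bar>) integrable_on {u..v}"
      using i by (auto intro!: integrable_diff integrable_on_mult_right)
    ultimately show ?thesis
      using integral_norm_bound_integral[of "\<lambda>t. c * h t - h t * q t" "{u..v}" "\<lambda>t. e * \<bar>h t\<bar>"]
      by simp
  qed
  finally show ?thesis by simp
qed

lemma uniform_modulus:
  fixes q :: "real \<Rightarrow> real"
  assumes q: "continuous_on {a..b} q" and e: "e > 0"
  obtains d where "d > 0" "\<And>s t. s \<in> {a..b} \<Longrightarrow> t \<in> {a..b} \<Longrightarrow> \<bar>s - t\<bar> < d \<Longrightarrow> \<bar>q s - q t\<bar> \<le> e"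
  using compact_uniformly_continuous[OF q] e unfolding uniformly_continuous_on_def dist_real_def
  by (metis compact_Icc less_imp_le)

text \<open>Argued through local errors rather than pointwise derivatives, since \<open>p'\<close>
  and \<open>q'\<close> are merely integrable. By uniform continuity \<open>p\<close> and
  \<open>q\<close> vary by at most \<open>e\<close> on short intervals, so freezing them there gives
  an admissible error.\<close>

lemma integral_product_rule:
  fixes p' q' :: "real \<Rightarrow> real"
  assumes ab: "a \<le> b"
    and p': "p' absolutely_integrable_on {a..b}" and q': "q' absolutely_integrable_on {a..b}"
    and p: "\<And>x. x \<in> {a..b} \<Longrightarrow> p x = p a + integral {a..x} p'"
    and q: "\<And>x. x \<in> {a..b} \<Longrightarrow> q x = q a + integral {a..x} q'"
  shows "p b * q b - p a * q a = integral {a..b} (\<lambda>t. p' t * q t + q' t * p t)"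
proof -
  have ii: "p' integrable_on {a..b}" "q' integrable_on {a..b}"
    using p' q' by (auto simp: absolutely_integrable_on_def)
  have cp: "continuous_on {a..b} p" and cq: "continuous_on {a..b} q"
    using ii by (auto simp: continuous_on_cong[OF refl p] continuous_on_cong[OF refl q]
        intro!: continuous_intros continuous_on_indefinite_integral simp del: atLeastAtMost_iff)
  have sub: "f absolutely_integrable_on {u..v}"
    if "a \<le> u" "v \<le> b" "f absolutely_integrable_on {a..b}" for u v and f :: "real \<Rightarrow> real"
    using that by (auto intro: absolutely_integrable_on_subinterval)
  show ?thesis
  proof (rule eq_integral_if_local_error_small[where l = "\<lambda>t. \<bar>p' t\<bar> + \<bar>q' t\<bar>" and p = "\<lambda>x. p x * q x", OF ab])
    show "(\<lambda>t. p' t * q t + q' t * p t) integrable_on {a..b}"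
      using absolutely_integrable_mult_continuous(1)[OF p' cq] absolutely_integrable_mult_continuous(1)[OF q' cp]
      by (auto simp: absolutely_integrable_on_def intro!: integrable_add)
    show "(\<lambda>t. \<bar>p' t\<bar> + \<bar>q' t\<bar>) integrable_on {a..b}" using p' q' by (auto simp: absolutely_integrable_on_def intro!: integrable_add)
    fix e :: real assume e: "e > 0"
    obtain d1 where d1: "d1 > 0" "\<And>s t. s \<in> {a..b} \<Longrightarrow> t \<in> {a..b} \<Longrightarrow> \<bar>s - t\<bar> < d1 \<Longrightarrow> \<bar>p s - p t\<bar> \<le> e"
      using uniform_modulus[OF cp e] by blast
    obtain d2 where d2: "d2 > 0" "\<And>s t. s \<in> {a..b} \<Longrightarrow> t \<in> {a..b} \<Longrightarrow> \<bar>s - t\<bar> < d2 \<Longrightarrow> \<bar>q s - q t\<bar> \<le> e"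
      using uniform_modulus[OF cq e] by blast
    show "\<exists>d>0. \<forall>u v. a \<le> u \<longrightarrow> u \<le> v \<longrightarrow> v \<le> b \<longrightarrow> v - u < d
      \<longrightarrow> \<bar>p v * q v - p u * q u - integral {u..v} (\<lambda>t. p' t * q t + q' t * p t)\<bar>
          \<le> e * integral {u..v} (\<lambda>t. \<bar>p' t\<bar> + \<bar>q' t\<bar>)"
    proof (intro exI[of _ "min d1 d2"] conjI allI impI)
      show "min d1 d2 > 0" using d1 d2 by simp
      fix u v assume uv: "a \<le> u" "u \<le> v" "v \<le> b" "v - u < min d1 d2"
      have c: "continuous_on {u..v} p" "continuous_on {u..v} q"
        using cp cq uv by (auto intro: continuous_on_subset)
      have s: "p' absolutely_integrable_on {u..v}" "q' absolutely_integrable_on {u..v}"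
        using sub uv p' q' by auto
      \<comment> \<open>\<open>q\<close> is frozen at the right end and \<open>p\<close> at the left
        end, matching the exact splitting \<open>q v * (p v - p u) + p u * (q v - q u)\<close> of
        the increment of the product.\<close>
      have P: "\<bar>q v * integral {u..v} p' - integral {u..v} (\<lambda>t. p' t * q t)\<bar> \<le> e * integral {u..v} (\<lambda>t. \<bar>p' t\<bar>)"
        using uv d2(2) by (intro integral_weighted_oscillation s c) auto
      have Q: "\<bar>p u * integral {u..v} q' - integral {u..v} (\<lambda>t. q' t * p t)\<bar> \<le> e * integral {u..v} (\<lambda>t. \<bar>q' t\<bar>)"
        using uv d1(2) by (intro integral_weighted_oscillation s c) auto
      have "p v - p u = integral {u..v} p'" "q v - q u = integral {u..v} q'"
        using p[of u] p[of v] q[of u] q[of v] uv integral_sub_eq[OF ii(1), of u v] integral_sub_eq[OF ii(2), of u v]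
        by auto
      then have 1: "p v * q v - p u * q u = q v * integral {u..v} p' + p u * integral {u..v} q'"
        by (simp add: algebra_simps flip: \<open>p v - p u = _\<close> \<open>q v - q u = _\<close>)
      have 2: "integral {u..v} (\<lambda>t. p' t * q t + q' t * p t)
         = integral {u..v} (\<lambda>t. p' t * q t) + integral {u..v} (\<lambda>t. q' t * p t)"
        using absolutely_integrable_mult_continuous(1)[OF s(1) c(2)] absolutely_integrable_mult_continuous(1)[OF s(2) c(1)]
        by (intro Henstock_Kurzweil_Integration.integral_add) (auto simp: absolutely_integrable_on_def)
      have 3: "integral {u..v} (\<lambda>t. \<bar>p' t\<bar> + \<bar>q' t\<bar>) = integral {u..v} (\<lambda>t. \<bar>p' t\<bar>) + integral {u..v} (\<lambda>t. \<bar>q' t\<bar>)"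
        using s by (intro Henstock_Kurzweil_Integration.integral_add) (auto simp: absolutely_integrable_on_def)
      show "\<bar>p v * q v - p u * q u - integral {u..v} (\<lambda>t. p' t * q t + q' t * p t)\<bar>
          \<le> e * integral {u..v} (\<lambda>t. \<bar>p' t\<bar> + \<bar>q' t\<bar>)"
        using P Q unfolding 1 2 3 distrib_left by linarith
    qed
  qed auto
qed

text \<open>Chain rule for \<open>exp\<close> of an indefinite integral \<open>L\<close>. The mean
  value theorem writes a local increment as \<open>exp z * (L v - L u)\<close>, and the intermediate
  value theorem finds a point \<open>x\<close> of the interval with \<open>L x = z\<close>, so that
  \<open>exp z\<close> is within \<open>e\<close> of \<open>exp (L t)\<close> on all of it.\<close>

lemma integral_exp_rule:
  fixes l :: "real \<Rightarrow> real"
  assumes ab: "a \<le> b" and l: "l absolutely_integrable_on {a..b}"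
  shows "exp (integral {a..b} l) - 1 = integral {a..b} (\<lambda>t. l t * exp (integral {a..t} l))"
proof -
  define L where "L x = integral {a..x} l" for x
  have ii: "l integrable_on {a..b}" using l by (auto simp: absolutely_integrable_on_def)
  have cL: "continuous_on {a..b} L"
    unfolding L_def by (rule continuous_on_indefinite_integral[OF ii])
  then have cE: "continuous_on {a..b} (\<lambda>x. exp (L x))" by (intro continuous_intros)
  have "exp (L b) - exp (L a) = integral {a..b} (\<lambda>t. l t * exp (L t))"
  proof (rule eq_integral_if_local_error_small[where l = "\<lambda>t. \<bar>l t\<bar>" and p = "\<lambda>x. exp (L x)", OF ab])
    show "(\<lambda>t. l t * exp (L t)) integrable_on {a..b}"
      using absolutely_integrable_mult_continuous(1)[OF l cE] by (auto simp: absolutely_integrable_on_def)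
    show "(\<lambda>t. \<bar>l t\<bar>) integrable_on {a..b}" using l by (auto simp: absolutely_integrable_on_def)
    fix e :: real assume e: "e > 0"
    obtain d where d: "d > 0" "\<And>s t. s \<in> {a..b} \<Longrightarrow> t \<in> {a..b} \<Longrightarrow> \<bar>s - t\<bar> < d \<Longrightarrow> \<bar>exp (L s) - exp (L t)\<bar> \<le> e"
      using uniform_modulus[OF cE e] by blast
    show "\<exists>d>0. \<forall>u v. a \<le> u \<longrightarrow> u \<le> v \<longrightarrow> v \<le> b \<longrightarrow> v - u < d
      \<longrightarrow> \<bar>exp (L v) - exp (L u) - integral {u..v} (\<lambda>t. l t * exp (L t))\<bar> \<le> e * integral {u..v} (\<lambda>t. \<bar>l t\<bar>)"
    proof (intro exI[of _ d] conjI allI impI d)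
      fix u v assume uv: "a \<le> u" "u \<le> v" "v \<le> b" "v - u < d"
      have c: "continuous_on {u..v} L" "continuous_on {u..v} (\<lambda>t. exp (L t))"
        using cL cE uv by (auto intro: continuous_on_subset)
      have s: "l absolutely_integrable_on {u..v}"
        using uv l by (auto intro: absolutely_integrable_on_subinterval)
      obtain x where x: "x \<in> {u..v}" "exp (L v) - exp (L u) = exp (L x) * (L v - L u)"
      proof -
        have "\<exists>z. exp (L v) - exp (L u) = exp z * (L v - L u) \<and> z \<in> closed_segment (L u) (L v)"
        proof (cases "L u = L v")
          case True then show ?thesis by (intro exI[of _ "L u"]) auto
        next
          case False
          then consider "L u < L v" | "L v < L u" by linarith
          then show ?thesis
          proof cases
            case 1
            with MVT2[of "L u" "L v" exp exp] obtain z where "L u < z" "z < L v" "exp (L v) - exp (L u) = (L v - L u) * exp z"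
              by (auto intro: DERIV_exp)
            then show ?thesis by (intro exI[of _ z]) (auto simp: closed_segment_eq_real_ivl)
          next
            case 2
            with MVT2[of "L v" "L u" exp exp] obtain z where "L v < z" "z < L u" "exp (L u) - exp (L v) = (L u - L v) * exp z"
              by (auto intro: DERIV_exp)
            then show ?thesis by (intro exI[of _ z]) (auto simp: closed_segment_eq_real_ivl algebra_simps)
          qed
        qed
        then obtain z where z: "exp (L v) - exp (L u) = exp z * (L v - L u)" "z \<in> closed_segment (L u) (L v)" by blast
        have "\<exists>x\<in>{u..v}. L x = z"
        proof (cases "L u \<le> L v")
          case True then show ?thesis
            using IVT'[of L u z v] c(1) uv z(2) by (auto simp: closed_segment_eq_real_ivl)
        next
          case False then show ?thesis
            using IVT2'[of L v z u] c(1) uv z(2) by (auto simp: closed_segment_eq_real_ivl)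
        qed
        then show ?thesis using that z(1) by blast
      qed
      have "L v - L u = integral {u..v} l" unfolding L_def using integral_sub_eq[OF ii, of u v] uv by auto
      moreover have "\<bar>exp (L x) * integral {u..v} l - integral {u..v} (\<lambda>t. l t * exp (L t))\<bar> \<le> e * integral {u..v} (\<lambda>t. \<bar>l t\<bar>)"
        using uv x d(2) by (intro integral_weighted_oscillation s c) auto
      ultimately show "\<bar>exp (L v) - exp (L u) - integral {u..v} (\<lambda>t. l t * exp (L t))\<bar> \<le> e * integral {u..v} (\<lambda>t. \<bar>l t\<bar>)"
        using x(2) by simp
    qed
  qed auto
  then show ?thesis by (simp add: L_def)
qed

section \<open>Linear estimates and Caratheodory equations\<close>

text \<open>The product rule for \<open>E * d\<close>, where the exponential rule supplies
  \<open>- c * E\<close> as the derivative of \<open>E\<close>. What survives under the integral is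
  the residual of \<open>g\<close> against the linear term \<open>c * d\<close>.\<close>

lemma integrating_factor:
  fixes c d g :: "real \<Rightarrow> real"
  assumes c: "c absolutely_integrable_on {a..b}" and g: "g absolutely_integrable_on {a..b}"
    and d: "\<And>x. x \<in> {a..b} \<Longrightarrow> d x = integral {a..x} g" and x: "x \<in> {a..b}"
  defines "E \<equiv> \<lambda>x. exp (- integral {a..x} c)"
  shows "continuous_on {a..b} E" "continuous_on {a..b} d"
    "E x * d x = integral {a..x} (\<lambda>t. E t * (g t - c t * d t))"
proof -
  have ii: "c integrable_on {a..b}" "g integrable_on {a..b}"
    using c g by (auto simp: absolutely_integrable_on_def)
  show cE: "continuous_on {a..b} E"
    unfolding E_def using ii by (intro continuous_intros continuous_on_indefinite_integral)
  show cd: "continuous_on {a..b} d"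
    using ii by (auto simp: continuous_on_cong[OF refl d] intro!: continuous_on_indefinite_integral
        simp del: atLeastAtMost_iff)
  have c': "(\<lambda>t. - c t) absolutely_integrable_on {a..y}" if "y \<in> {a..b}" for y
    using absolutely_integrable_on_subinterval[OF c, of a y] that
    by (auto simp: absolutely_integrable_on_def intro: integrable_neg)
  have sx: "f absolutely_integrable_on {a..x}" if "f absolutely_integrable_on {a..b}" for f :: "real \<Rightarrow> real"
    using absolutely_integrable_on_subinterval[OF that, of a x] x by auto
  have "E x * d x - E a * d a = integral {a..x} (\<lambda>t. (- c t * E t) * d t + g t * E t)"
  proof (rule integral_product_rule)
    show "a \<le> x" using x by simp
    show "(\<lambda>t. - c t * E t) absolutely_integrable_on {a..x}"
      using c'[OF x] cE x
      by (intro absolutely_integrable_mult_continuous) (auto intro: continuous_on_subset)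
    show "g absolutely_integrable_on {a..x}" by (rule sx[OF g])
    show "E y = E a + integral {a..y} (\<lambda>t. - c t * E t)" if "y \<in> {a..x}" for y
      using integral_exp_rule[of a y "\<lambda>t. - c t"] c'[of y] that x by (simp add: E_def)
    show "d y = d a + integral {a..y} g" if "y \<in> {a..x}" for y
      using d[of y] d[of a] that x by simp
  qed
  moreover have "d a = 0" using d[of a] x by simp
  ultimately show "E x * d x = integral {a..x} (\<lambda>t. E t * (g t - c t * d t))"
    by (simp add: algebra_simps)
qed

text \<open>With the coefficient \<open>s * (sgn (d t) * l t)\<close>, where \<open>s = -1\<close>
  for the lower and \<open>s = 1\<close> for the upper bound, the residual is bounded by
  \<open>k\<close> on the required side. The factor \<open>E\<close> lies between
  \<open>exp (- ?M)\<close> and \<open>exp ?M\<close>; one such exponential is lost under the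
  integral and one in removing \<open>E x\<close>, whence the factor \<open>2\<close> in the
  exponents.\<close>

lemma gronwall_bounds:
  fixes d g k l :: "real \<Rightarrow> real"
  assumes l: "l absolutely_integrable_on {a..b}" "\<And>t. t \<in> {a..b} \<Longrightarrow> 0 \<le> l t"
    and g: "g absolutely_integrable_on {a..b}"
    and k: "k absolutely_integrable_on {a..b}" "\<And>t. t \<in> {a..b} \<Longrightarrow> 0 \<le> k t"
    and d: "\<And>x. x \<in> {a..b} \<Longrightarrow> d x = integral {a..x} g" and x: "x \<in> {a..b}"
  shows gronwall_lower: "(\<And>t. t \<in> {a..b} \<Longrightarrow> k t - l t * \<bar>d t\<bar> \<le> g t)
      \<Longrightarrow> exp (- 2 * integral {a..b} l) * integral {a..x} k \<le> d x"
    and gronwall_upper: "(\<And>t. t \<in> {a..b} \<Longrightarrow> g t \<le> k t + l t * \<bar>d t\<bar>)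
      \<Longrightarrow> d x \<le> exp (2 * integral {a..b} l) * integral {a..x} k"
proof -
  let ?M = "integral {a..b} l"
  have cd: "continuous_on {a..b} d"
    by (rule integrating_factor(2)[OF g g d x])
  \<comment> \<open>The bounds become linear because \<open>l * \<bar>d\<bar> = (sgn d * l) * d\<close>.\<close>
  have ci: "(\<lambda>t. s * (sgn (d t) * l t)) absolutely_integrable_on {a..b}" for s
  proof -
    have "(\<lambda>t. sgn (d t) * l t) absolutely_integrable_on {a..b}"
    proof (rule absolutely_integrable_bounded_measurable_product_real)
      show "(\<lambda>t. sgn (d t)) \<in> borel_measurable (lebesgue_on {a..b})"
      proof -
        have [measurable]: "d \<in> borel_measurable (lebesgue_on {a..b})"
          by (rule continuous_imp_measurable_on_sets_lebesgue[OF cd]) simp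
        show ?thesis by measurable
      qed
      show "bounded ((\<lambda>t. sgn (d t)) ` {a..b})"
        by (intro boundedI[of _ 1]) (auto simp: sgn_real_def)
    qed (use l in auto)
    then show ?thesis by (simp add: set_integrable_mult_right)
  qed
  have kx: "k absolutely_integrable_on {a..x}"
    using absolutely_integrable_on_subinterval[OF k(1), of a x] x by auto
  then have kn: "integral {a..x} k \<ge> 0"
    using k(2) x by (intro Henstock_Kurzweil_Integration.integral_nonneg) (auto simp: absolutely_integrable_on_def)
  have main: "E x * d x = integral {a..x} (\<lambda>t. E t * (g t - s * (sgn (d t) * l t) * d t))
    \<and> (\<lambda>t. E t * (g t - s * (sgn (d t) * l t) * d t)) integrable_on {a..x}
    \<and> (\<lambda>t. E t * k t) integrable_on {a..x}
    \<and> (\<forall>t\<in>{a..b}. exp (- ?M) \<le> E t \<and> E t \<le> exp ?M)"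
    if s: "\<bar>s\<bar> = 1" and E: "E = (\<lambda>x. exp (- integral {a..x} (\<lambda>t. s * (sgn (d t) * l t))))" for s E
  proof (intro conjI ballI)
    have F: "continuous_on {a..b} E"
      "E x * d x = integral {a..x} (\<lambda>t. E t * (g t - s * (sgn (d t) * l t) * d t))"
      unfolding E by (rule integrating_factor[OF ci[of s] g d x]; simp)+
    show "E x * d x = integral {a..x} (\<lambda>t. E t * (g t - s * (sgn (d t) * l t) * d t))"
      by (rule F(2))
    have "(\<lambda>t. E t * (g t - s * (sgn (d t) * l t) * d t)) absolutely_integrable_on {a..b}"
      by (intro absolutely_integrable_mult_continuous F(1) set_integral_diff g ci cd)
    from absolutely_integrable_on_subinterval[OF this, of a x]
    show "(\<lambda>t. E t * (g t - s * (sgn (d t) * l t) * d t)) integrable_on {a..x}"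
      using x by (auto simp: absolutely_integrable_on_def)
    have "(\<lambda>t. E t * k t) absolutely_integrable_on {a..b}"
      by (intro absolutely_integrable_mult_continuous F(1) k)
    from absolutely_integrable_on_subinterval[OF this, of a x]
    show "(\<lambda>t. E t * k t) integrable_on {a..x}"
      using x by (auto simp: absolutely_integrable_on_def)
    fix t assume t: "t \<in> {a..b}"
    have lt: "(\<lambda>t. s * (sgn (d t) * l t)) integrable_on {a..t}" "l integrable_on {a..t}"
      using absolutely_integrable_on_subinterval[OF ci[of s], of a t]
        absolutely_integrable_on_subinterval[OF l(1), of a t] t by (auto simp: absolutely_integrable_on_def)
    have "norm (integral {a..t} (\<lambda>t. s * (sgn (d t) * l t))) \<le> integral {a..t} l"
    proof (rule integral_norm_bound_integral[OF lt])
      fix u assume u: "u \<in> {a..t}"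
      then have "\<bar>sgn (d u)\<bar> * \<bar>l u\<bar> \<le> 1 * \<bar>l u\<bar>" by (intro mult_right_mono) (auto simp: sgn_real_def)
      then show "norm (s * (sgn (d u) * l u)) \<le> l u"
        using l(2)[of u] u t s by (simp add: abs_mult)
    qed
    also have "\<dots> \<le> ?M"
      using l t lt by (intro integral_subset_le) (auto simp: absolutely_integrable_on_def)
    finally have "\<bar>integral {a..t} (\<lambda>t. s * (sgn (d t) * l t))\<bar> \<le> ?M" by simp
    then show "exp (- ?M) \<le> E t" "E t \<le> exp ?M" unfolding E by auto
  qed
  have sg: "sgn y * y = \<bar>y\<bar>" for y :: real by (simp add: sgn_real_def)
  show "exp (- 2 * ?M) * integral {a..x} k \<le> d x"
    if gl: "\<And>t. t \<in> {a..b} \<Longrightarrow> k t - l t * \<bar>d t\<bar> \<le> g t"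
  proof -
    define E where "E x = exp (- integral {a..x} (\<lambda>t. (-1) * (sgn (d t) * l t)))" for x
    have F: "E x * d x = integral {a..x} (\<lambda>t. E t * (g t - (-1) * (sgn (d t) * l t) * d t))"
      "(\<lambda>t. E t * (g t - (-1) * (sgn (d t) * l t) * d t)) integrable_on {a..x}"
      "(\<lambda>t. E t * k t) integrable_on {a..x}"
      "\<And>t. t \<in> {a..b} \<Longrightarrow> exp (- ?M) \<le> E t \<and> E t \<le> exp ?M"
      using main[of "-1" E] by (auto simp: E_def[abs_def])
    have "exp (- ?M) * integral {a..x} k = integral {a..x} (\<lambda>t. exp (- ?M) * k t)" by simp
    also have "\<dots> \<le> integral {a..x} (\<lambda>t. E t * (g t - (-1) * (sgn (d t) * l t) * d t))"
    proof (rule integral_le)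
      show "(\<lambda>t. exp (- ?M) * k t) integrable_on {a..x}"
        using kx by (auto simp: absolutely_integrable_on_def intro: integrable_on_mult_right)
      fix t assume "t \<in> {a..x}"
      then have t: "t \<in> {a..b}" using x by auto
      have "(-1) * (sgn (d t) * l t) * d t = - (l t * \<bar>d t\<bar>)" by (simp add: sg[symmetric] mult_ac)
      then have "k t \<le> g t - (-1) * (sgn (d t) * l t) * d t" using gl[OF t] by linarith
      then show "exp (- ?M) * k t \<le> E t * (g t - (-1) * (sgn (d t) * l t) * d t)"
        using F(4)[OF t] k(2)[OF t] by (intro mult_mono) (auto simp: E_def)
    qed (use F in auto)
    also have "\<dots> = E x * d x" using F(1) by simp
    finally have *: "exp (- ?M) * integral {a..x} k \<le> E x * d x" .
    have Ex: "E x > 0" "E x \<le> exp ?M" using F(4)[OF x] by (auto simp: E_def)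
    \<comment> \<open>The sign of \<open>d x\<close> has to be known before \<open>E x\<close> can
      be replaced by its upper bound; it follows from \<open>k\<close> being nonnegative.\<close>
    have "0 \<le> exp (- ?M) * integral {a..x} k" using kn by simp
    with * have "0 \<le> E x * d x" by linarith
    with Ex have "0 \<le> d x" by (simp add: zero_le_mult_iff)
    then have "E x * d x \<le> exp ?M * d x" using Ex by (intro mult_right_mono) auto
    with * have "exp (- ?M) * (exp (- ?M) * integral {a..x} k) \<le> exp (- ?M) * (exp ?M * d x)"
      by (intro mult_left_mono) auto
    then show ?thesis by (simp add: mult.assoc[symmetric] flip: exp_add)
  qed
  show "d x \<le> exp (2 * ?M) * integral {a..x} k"
    if gl: "\<And>t. t \<in> {a..b} \<Longrightarrow> g t \<le> k t + l t * \<bar>d t\<bar>"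
  proof -
    define E where "E x = exp (- integral {a..x} (\<lambda>t. 1 * (sgn (d t) * l t)))" for x
    have F: "E x * d x = integral {a..x} (\<lambda>t. E t * (g t - 1 * (sgn (d t) * l t) * d t))"
      "(\<lambda>t. E t * (g t - 1 * (sgn (d t) * l t) * d t)) integrable_on {a..x}"
      "(\<lambda>t. E t * k t) integrable_on {a..x}"
      "\<And>t. t \<in> {a..b} \<Longrightarrow> exp (- ?M) \<le> E t \<and> E t \<le> exp ?M"
      using main[of "1" E] by (auto simp: E_def[abs_def])
    have "E x * d x \<le> integral {a..x} (\<lambda>t. exp ?M * k t)"
      unfolding F(1)
    proof (rule integral_le)
      show "(\<lambda>t. exp ?M * k t) integrable_on {a..x}"
        using kx by (auto simp: absolutely_integrable_on_def intro: integrable_on_mult_right)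
      fix t assume "t \<in> {a..x}"
      then have t: "t \<in> {a..b}" using x by auto
      have "1 * (sgn (d t) * l t) * d t = l t * \<bar>d t\<bar>" by (simp add: sg[symmetric] mult_ac)
      then have "g t - 1 * (sgn (d t) * l t) * d t \<le> k t" using gl[OF t] by linarith
      then have "E t * (g t - 1 * (sgn (d t) * l t) * d t) \<le> E t * k t"
        by (intro mult_left_mono) (auto simp: E_def)
      also have "\<dots> \<le> exp ?M * k t"
        using F(4)[OF t] k(2)[OF t] by (intro mult_right_mono) auto
      finally show "E t * (g t - 1 * (sgn (d t) * l t) * d t) \<le> exp ?M * k t" .
    qed (use F in auto)
    then have *: "E x * d x \<le> exp ?M * integral {a..x} k" by simp
    have Ex: "exp (- ?M) \<le> E x" using F(4)[OF x] by auto
    \<comment> \<open>For nonnegative \<open>d x\<close> the lower bound on \<open>E x\<close> may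
      be inserted; for negative \<open>d x\<close> the right-hand side is nonnegative
      anyway.\<close>
    show ?thesis
    proof (cases "d x \<ge> 0")
      case True
      then have "exp (- ?M) * d x \<le> E x * d x" using Ex by (intro mult_right_mono) auto
      with * have "exp ?M * (exp (- ?M) * d x) \<le> exp ?M * (exp ?M * integral {a..x} k)"
        by (intro mult_left_mono) auto
      then show ?thesis by (simp add: mult.assoc[symmetric] flip: exp_add)
    next
      case False
      then show ?thesis using kn by (meson less_imp_le linorder_not_le mult_nonneg_nonneg exp_ge_zero order.trans)
    qed
  qed
qed

section \<open>Existence of solutions by a weighted contraction\<close>

lemma caratheodory_solution:
  fixes G :: "real \<Rightarrow> real \<Rightarrow> real"
  assumes ab: "a \<le> b"
    and l: "l absolutely_integrable_on {a..b}" "\<And>t. t \<in> {a..b} \<Longrightarrow> 0 \<le> l t"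
    and G: "\<And>w. continuous_on {a..b} w \<Longrightarrow> (\<lambda>t. G t (w t)) absolutely_integrable_on {a..b}"
    and lip: "\<And>t y z. t \<in> {a..b} \<Longrightarrow> \<bar>G t y - G t z\<bar> \<le> l t * \<bar>y - z\<bar>"
  obtains v where "continuous_on {a..b} v" "\<And>x. x \<in> {a..b} \<Longrightarrow> v x = integral {a..x} (\<lambda>t. G t (v t))"
proof -
  define L where "L x = integral {a..x} l" for x
  \<comment> \<open>Clamping to the interval extends \<open>J u\<close> to a bounded continuous
    function on the whole line, so that Banach's fixed point theorem applies in the complete space
    of such functions.\<close>
  define r where "r x = max a (min b x)" for x
  have r: "r x \<in> {a..b}" for x using ab by (auto simp: r_def)
  have cr: "continuous_on UNIV r" unfolding r_def by (intro continuous_intros)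
  have li: "l integrable_on {a..b}" using l by (auto simp: absolutely_integrable_on_def)
  have cL: "continuous_on {a..b} L" unfolding L_def by (rule continuous_on_indefinite_integral[OF li])
  \<comment> \<open>Picard iteration for \<open>u = exp (- 2 L) v\<close>; the weight makes it a contraction on all of the interval.\<close>
  define J where "J u x = exp (- 2 * L x) * integral {a..x} (\<lambda>t. G t (exp (2 * L t) * u t))"
    for u :: "real \<Rightarrow> real" and x
  have Gu: "(\<lambda>t. G t (exp (2 * L t) * u t)) absolutely_integrable_on {a..x}"
    if "continuous_on {a..b} u" "x \<in> {a..b}" for u x
  proof -
    have "(\<lambda>t. G t (exp (2 * L t) * u t)) absolutely_integrable_on {a..b}"
      using that cL by (intro G continuous_intros)
    from absolutely_integrable_on_subinterval[OF this, of a x] that show ?thesis by auto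
  qed
  have cJ: "continuous_on {a..b} (J u)" if "continuous_on {a..b} u" for u
    unfolding J_def[abs_def] using Gu[OF that, of b] ab cL
    by (intro continuous_intros continuous_on_indefinite_integral) (auto simp: absolutely_integrable_on_def)
  have bJ: "(\<lambda>x. J u (r x)) \<in> bcontfun" if "continuous_on {a..b} u" for u
  proof -
    have "bounded (J u ` {a..b})"
      using compact_continuous_image[OF cJ[OF that]] by (simp add: compact_imp_bounded)
    then have "bounded (range (\<lambda>x. J u (r x)))"
      by (rule bounded_subset) (use r in auto)
    moreover have "continuous_on UNIV (\<lambda>x. J u (r x))"
      using continuous_on_compose2[OF cJ[OF that] cr] r by blast
    ultimately show ?thesis by (simp add: bcontfun_def)
  qed
  define T where "T u = Bcontfun (\<lambda>x. J (apply_bcontfun u) (r x))" for u :: "real \<Rightarrow>\<^sub>C real"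
  have cu: "continuous_on {a..b} (apply_bcontfun u)" for u :: "real \<Rightarrow>\<^sub>C real"
    using apply_bcontfun[of u] by (auto simp: bcontfun_def intro: continuous_on_subset)
  have T: "apply_bcontfun (T u) x = J (apply_bcontfun u) (r x)" for u x
    unfolding T_def by (subst Bcontfun_inverse[OF bJ[OF cu]]) simp
  have "\<exists>!u. T u = u"
  proof (rule banach_fix_type[of "1/2"])
    show "\<forall>u w. dist (T u) (T w) \<le> 1/2 * dist u w"
    proof (intro allI dist_bound)
      fix u w :: "real \<Rightarrow>\<^sub>C real" and y
      define x where "x = r y"
      have x: "x \<in> {a..b}" using r x_def by simp
      let ?D = "dist u w"
      have lx: "l absolutely_integrable_on {a..x}"
        using absolutely_integrable_on_subinterval[OF l(1), of a x] x by auto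
      have l2x: "(\<lambda>t. 2 * l t) absolutely_integrable_on {a..x}"
        using lx by (auto simp: absolutely_integrable_on_def abs_mult)
      have cLx: "continuous_on {a..x} L" using cL x by (auto intro: continuous_on_subset)
      have lE: "(\<lambda>t. l t * exp (2 * L t)) absolutely_integrable_on {a..x}"
        by (intro absolutely_integrable_mult_continuous lx continuous_intros cLx)
      \<comment> \<open>The exponential rule evaluates the weighted mass of \<open>l\<close>
        exactly. After multiplication by \<open>exp (- 2 * L x)\<close> its factor
        \<open>1/2\<close> is the contraction constant.\<close>
      have "exp (2 * L x) - 1 = integral {a..x} (\<lambda>t. 2 * (l t * exp (2 * L t)))"
        using integral_exp_rule[OF _ l2x] x unfolding L_def by (simp add: mult.assoc)
      then have IE: "integral {a..x} (\<lambda>t. l t * exp (2 * L t)) = (exp (2 * L x) - 1) / 2" by simp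
      let ?g = "\<lambda>u t. G t (exp (2 * L t) * apply_bcontfun u t)"
      have gi: "?g u integrable_on {a..x}" for u
        using Gu[OF cu x] by (auto simp: absolutely_integrable_on_def)
      have "\<bar>integral {a..x} (?g u) - integral {a..x} (?g w)\<bar> = norm (integral {a..x} (\<lambda>t. ?g u t - ?g w t))"
        using gi by (subst Henstock_Kurzweil_Integration.integral_diff) auto
      also have "\<dots> \<le> integral {a..x} (\<lambda>t. ?D * (l t * exp (2 * L t)))"
      proof (rule integral_norm_bound_integral)
        show "(\<lambda>t. ?g u t - ?g w t) integrable_on {a..x}" by (intro integrable_diff gi)
        show "(\<lambda>t. ?D * (l t * exp (2 * L t))) integrable_on {a..x}"
          using lE by (intro integrable_on_mult_right) (auto simp: absolutely_integrable_on_def)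
        fix t assume t: "t \<in> {a..x}"
        then have tb: "t \<in> {a..b}" using x by auto
        have "norm (?g u t - ?g w t) \<le> l t * \<bar>exp (2 * L t) * apply_bcontfun u t - exp (2 * L t) * apply_bcontfun w t\<bar>"
          using lip[OF tb] by simp
        also have "\<dots> = l t * (exp (2 * L t) * dist (apply_bcontfun u t) (apply_bcontfun w t))"
          by (simp add: dist_real_def abs_mult flip: right_diff_distrib)
        also have "\<dots> \<le> l t * (exp (2 * L t) * ?D)"
          using l(2)[OF tb] by (intro mult_left_mono dist_bounded) auto
        finally show "norm (?g u t - ?g w t) \<le> ?D * (l t * exp (2 * L t))" by (simp add: mult_ac)
      qed
      also have "\<dots> = ?D * ((exp (2 * L x) - 1) / 2)" using IE by simp
      also have "\<dots> \<le> ?D * (exp (2 * L x) / 2)" by (intro mult_left_mono) auto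
      finally have le: "\<bar>integral {a..x} (?g u) - integral {a..x} (?g w)\<bar> \<le> ?D * (exp (2 * L x) / 2)" .
      have "dist (T u y) (T w y) = exp (- 2 * L x) * \<bar>integral {a..x} (?g u) - integral {a..x} (?g w)\<bar>"
        unfolding T dist_real_def J_def x_def[symmetric] by (simp add: abs_mult flip: right_diff_distrib)
      also have "\<dots> \<le> exp (- 2 * L x) * (?D * (exp (2 * L x) / 2))" by (intro mult_left_mono le) auto
      also have "\<dots> = 1/2 * ?D" by (simp add: mult_ac exp_minus)
      finally show "dist (T u y) (T w y) \<le> 1/2 * ?D" .
    qed
  qed auto
  then obtain u where u: "T u = u" by blast
  show ?thesis
  proof (rule that)
    show "continuous_on {a..b} (\<lambda>t. exp (2 * L t) * apply_bcontfun u t)"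
      using cu cL by (intro continuous_intros)
    fix x assume x: "x \<in> {a..b}"
    then have "r x = x" by (auto simp: r_def)
    then have "apply_bcontfun u x = J (apply_bcontfun u) x" using T[of u x] u by simp
    then show "exp (2 * L x) * apply_bcontfun u x = integral {a..x} (\<lambda>t. G t (exp (2 * L t) * apply_bcontfun u t))"
      unfolding J_def by (simp add: mult.assoc[symmetric] flip: exp_add)
  qed
qed

section \<open>The Hamilton--Jacobi--Bellman family\<close>

text \<open>Total boundedness provides finite nets of radius \<open>1 / real (Suc n)\<close>; the
  centres for all \<open>n\<close> together form the dense set.\<close>

lemma compact_metric_countable_dense:
  fixes U :: "'u::metric_space set"
  assumes "compact U"
  obtains D where "countable D" "D \<subseteq> U" "U \<subseteq> closure D"
proof -
  have "\<forall>n::nat. \<exists>k. finite k \<and> k \<subseteq> U \<and> U \<subseteq> (\<Union>x\<in>k. ball x (1 / real (Suc n)))"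
    using seq_compact_imp_totally_bounded[of U] assms by (auto simp: compact_eq_seq_compact_metric)
  from choice[OF this] obtain k
    where k: "\<And>n::nat. finite (k n) \<and> k n \<subseteq> U \<and> U \<subseteq> (\<Union>x\<in>k n. ball x (1 / real (Suc n)))"
    by blast
  show ?thesis
  proof (rule that)
    show "countable (\<Union>n. k n)" using k by (intro countable_UN) (auto intro: countable_finite)
    show "(\<Union>n. k n) \<subseteq> U" using k by auto
    show "U \<subseteq> closure (\<Union>n. k n)"
    proof
      fix x assume x: "x \<in> U"
      show "x \<in> closure (\<Union>n. k n)"
        unfolding closure_approachable
      proof (intro allI impI)
        fix e :: real assume "e > 0"
        then obtain n where n: "1 / real (Suc n) < e" using nat_approx_posE by blast
        obtain y where "y \<in> k n" "dist y x < 1 / real (Suc n)" using k[of n] x by auto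
        then show "\<exists>y\<in>\<Union>n. k n. dist y x < e" using n by (intro bexI[of _ y]) auto
      qed
    qed
  qed
qed

lemma INF_compact_attained:
  fixes h :: "'u::topological_space \<Rightarrow> real"
  assumes "compact U" "U \<noteq> {}" "continuous_on U h"
  obtains \<eta> where "\<eta> \<in> U" "(INF \<eta>\<in>U. h \<eta>) = h \<eta>" "\<And>\<xi>. \<xi> \<in> U \<Longrightarrow> h \<eta> \<le> h \<xi>"
proof -
  obtain \<eta> where \<eta>: "\<eta> \<in> U" "\<forall>\<xi>\<in>U. h \<eta> \<le> h \<xi>" using continuous_attains_inf[OF assms] by blast
  then have "(INF \<eta>\<in>U. h \<eta>) = h \<eta>" by (intro cInf_eq_minimum) auto
  with \<eta> that show ?thesis by blast
qed

text \<open>Continuity in \<eta> lets the infimum run over a countable dense subset, and countable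
  infima preserve measurability.\<close>

lemma borel_measurable_INF_compact:
  fixes q :: "'a \<Rightarrow> 'u::metric_space \<Rightarrow> real"
  assumes U: "compact U" "U \<noteq> {}"
    and m: "\<And>\<eta>. \<eta> \<in> U \<Longrightarrow> (\<lambda>t. q t \<eta>) \<in> borel_measurable M"
    and c: "\<And>t. t \<in> space M \<Longrightarrow> continuous_on U (q t)"
  shows "(\<lambda>t. INF \<eta>\<in>U. q t \<eta>) \<in> borel_measurable M"
proof -
  obtain D where D: "countable D" "D \<subseteq> U" "U \<subseteq> closure D"
    using compact_metric_countable_dense[OF U(1)] .
  then have D0: "D \<noteq> {}" using U by auto
  have eq: "(INF \<eta>\<in>U. q t \<eta>) = (INF \<eta>\<in>D. q t \<eta>)" if t: "t \<in> space M" for t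
  proof -
    obtain \<eta> where \<eta>: "\<eta> \<in> U" "(INF \<eta>\<in>U. q t \<eta>) = q t \<eta>" "\<And>\<xi>. \<xi> \<in> U \<Longrightarrow> q t \<eta> \<le> q t \<xi>"
      using INF_compact_attained[OF U c[OF t]] by blast
    have bdd: "bdd_below (q t ` D)" using \<eta>(3) D by (auto intro!: bdd_belowI)
    have "q t \<eta> \<le> (INF \<eta>\<in>D. q t \<eta>)" using \<eta>(3) D D0 by (intro cINF_greatest) auto
    moreover have "(INF \<eta>\<in>D. q t \<eta>) \<le> q t \<eta> + e" if e: "e > 0" for e
    proof -
      obtain d where d: "d > 0" "\<And>\<xi>. \<xi> \<in> U \<Longrightarrow> dist \<xi> \<eta> < d \<Longrightarrow> dist (q t \<xi>) (q t \<eta>) < e"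
        using c[OF t, unfolded continuous_on_iff, rule_format, OF \<eta>(1) e] by blast
      obtain \<xi> where \<xi>: "\<xi> \<in> D" "dist \<xi> \<eta> < d"
        using subsetD[OF D(3) \<eta>(1)] d(1) unfolding closure_approachable by blast
      have "(INF \<eta>\<in>D. q t \<eta>) \<le> q t \<xi>" using bdd \<xi> by (intro cINF_lower)
      also have "\<dots> \<le> q t \<eta> + e" using d(2)[of \<xi>] \<xi> D(2) by (auto simp: dist_real_def)
      finally show ?thesis .
    qed
    then have "(INF \<eta>\<in>D. q t \<eta>) \<le> q t \<eta>" by (rule field_le_epsilon)
    ultimately show ?thesis using \<eta>(2) by simp
  qed
  have "(\<lambda>t. INF \<eta>\<in>D. q t \<eta>) \<in> borel_measurable M"
    using D m by (intro borel_measurable_cINF_real) auto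
  then show ?thesis by (subst measurable_cong[OF eq])
qed

lemma borel_measurable_lebesgue_onI:
  fixes h :: "'a::euclidean_space \<Rightarrow> real"
  assumes "h \<in> borel_measurable (restrict_space borel S)"
  shows "h \<in> borel_measurable (lebesgue_on S)"
proof (rule measurableI)
  fix Y :: "real set" assume "Y \<in> sets borel"
  from measurable_sets[OF assms this]
  obtain Z where Z: "Z \<in> sets borel" "h -` Y \<inter> S = S \<inter> Z"
    by (auto simp: sets_restrict_space space_restrict_space)
  then have "Z \<in> sets lebesgue" by (simp add: sets_completionI_sets)
  with Z show "h -` Y \<inter> space (lebesgue_on S) \<in> sets (lebesgue_on S)"
    by (auto simp: sets_restrict_space space_restrict_space)
qed auto

text \<open>A vanishing integral would force \<open>m t = 0\<close> almost everywhere by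
  nonnegativity; together with \<open>pos\<close> the whole interval would then be null.\<close>

lemma integral_pos_of_ae_pos:
  fixes m :: "real \<Rightarrow> real"
  assumes m: "m absolutely_integrable_on {a..b}" and ab: "a < b"
    and nn: "\<And>t. t \<in> {a..b} \<Longrightarrow> 0 \<le> m t"
    and pos: "negligible {t \<in> {a..b}. m t = 0}"
  shows "0 < integral {a..b} m"
proof (rule ccontr)
  assume "\<not> 0 < integral {a..b} m"
  moreover have mi: "m integrable_on {a..b}" using m by (auto simp: absolutely_integrable_on_def)
  ultimately have "integral {a..b} m = 0"
    using Henstock_Kurzweil_Integration.integral_nonneg[OF mi nn] by linarith
  then have "(m has_integral 0) {a..b}" using mi by (simp add: has_integral_iff)
  then have "integral\<^sup>L (lebesgue_on {a..b}) m = 0"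
    using lebesgue_integral_eq_integral[of "{a..b}" m] m \<open>integral {a..b} m = 0\<close>
    by (simp add: set_integrable_def integrable_restrict_space)
  moreover have "integrable (lebesgue_on {a..b}) m"
    using m by (simp add: set_integrable_def integrable_restrict_space)
  ultimately have "AE t in lebesgue_on {a..b}. m t = 0"
    using integral_nonneg_eq_0_iff_AE[of "lebesgue_on {a..b}" m] nn by (auto simp: AE_restrict_space_iff)
  then have "AE t in lebesgue. t \<in> {a..b} \<longrightarrow> m t = 0"
    by (simp add: AE_restrict_space_iff)
  then obtain N where "N \<in> null_sets lebesgue" "{t \<in> space lebesgue. \<not> (t \<in> {a..b} \<longrightarrow> m t = 0)} \<subseteq> N"
    unfolding eventually_ae_filter by blast
  then have "negligible {t. \<not> (t \<in> {a..b} \<longrightarrow> m t = 0)}"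
    by (auto simp: negligible_iff_null_sets[symmetric] intro: negligible_subset)
  then have "negligible ({t \<in> {a..b}. m t = 0} \<union> {t. \<not> (t \<in> {a..b} \<longrightarrow> m t = 0)})"
    using pos by simp
  then have "negligible {a..b}" by (rule negligible_subset) auto
  then show False using ab by (simp add: negligible_interval[of a b, unfolded box_real])
qed

text \<open>The two bounds make \<Phi> Lipschitz, hence continuous, and the lower one carries it
  past every level in both directions, so the intermediate value theorem applies.\<close>

lemma surj_of_slope_bounds:
  fixes \<Phi> :: "real \<Rightarrow> real"
  assumes c: "c > 0"
    and lo: "\<And>\<alpha> \<beta>. \<alpha> \<le> \<beta> \<Longrightarrow> c * (\<beta> - \<alpha>) \<le> \<Phi> \<beta> - \<Phi> \<alpha>"
    and hi: "\<And>\<alpha> \<beta>. \<alpha> \<le> \<beta> \<Longrightarrow> \<Phi> \<beta> - \<Phi> \<alpha> \<le> K * (\<beta> - \<alpha>)"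
  obtains \<alpha> where "\<Phi> \<alpha> = y"
proof -
  have K: "K \<ge> 0" using lo[of 0 1] hi[of 0 1] c by simp
  have "K-lipschitz_on UNIV \<Phi>"
  proof (rule lipschitz_onI)
    fix x y :: real
    show "dist (\<Phi> x) (\<Phi> y) \<le> K * dist x y"
    proof (cases "x \<le> y")
      case True
      then have "0 \<le> c * (y - x)" using c by simp
      then show ?thesis using lo[OF True] hi[OF True] True by (simp add: dist_real_def)
    next
      case False
      then have "y \<le> x" "0 \<le> c * (x - y)" using c by auto
      then show ?thesis using lo[of y x] hi[of y x] by (simp add: dist_real_def)
    qed
  qed (rule K)
  then have cont: "continuous_on S \<Phi>" for S
    using lipschitz_on_continuous_on continuous_on_subset[OF _ subset_UNIV] by blast
  \<comment> \<open>Over a distance \<open>R\<close> from \<open>0\<close> the lower slope bound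
    moves \<Phi> by at least \<open>\<bar>y - \<Phi> 0\<bar>\<close>.\<close>
  define R where "R = \<bar>y - \<Phi> 0\<bar> / c"
  have R: "R \<ge> 0" "c * R = \<bar>y - \<Phi> 0\<bar>" using c by (auto simp: R_def)
  have "\<Phi> (- R) \<le> y" "y \<le> \<Phi> R"
    using lo[of "-R" 0] lo[of 0 R] R by simp_all
  moreover have "- R \<le> R" using R by simp
  ultimately obtain x where "\<Phi> x = y" using IVT'[of \<Phi> "-R" y R] cont by blast
  then show ?thesis by (rule that)
qed

text \<open>To be used with \<open>q = 2/\<sigma>\<^sup>2\<close>, \<open>b = 2\<mu>/\<sigma>\<^sup>2\<close>, and \<open>f\<close> standing for \<open>2f/\<sigma>\<^sup>2\<close>, all set to \<open>0\<close> on the exceptional null set.\<close>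

locale hjb_data =
  fixes A B :: real and U :: "'u::metric_space set"
    and q b f :: "real \<Rightarrow> 'u \<Rightarrow> real" and \<kappa> l \<phi> :: "real \<Rightarrow> real"
  assumes AB: "A < B" and U: "compact U" "U \<noteq> {}"
    and cont: "t \<in> {A..B} \<Longrightarrow> continuous_on U (q t)" "t \<in> {A..B} \<Longrightarrow> continuous_on U (b t)"
      "t \<in> {A..B} \<Longrightarrow> continuous_on U (f t)"
    and meas: "\<eta> \<in> U \<Longrightarrow> (\<lambda>t. q t \<eta>) \<in> borel_measurable (lebesgue_on {A..B})"
      "\<eta> \<in> U \<Longrightarrow> (\<lambda>t. b t \<eta>) \<in> borel_measurable (lebesgue_on {A..B})"
      "\<eta> \<in> U \<Longrightarrow> (\<lambda>t. f t \<eta>) \<in> borel_measurable (lebesgue_on {A..B})"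
    and int: "\<kappa> absolutely_integrable_on {A..B}" "l absolutely_integrable_on {A..B}"
      "\<phi> absolutely_integrable_on {A..B}"
    and bounds: "t \<in> {A..B} \<Longrightarrow> \<eta> \<in> U \<Longrightarrow> 0 \<le> q t \<eta>" "t \<in> {A..B} \<Longrightarrow> \<eta> \<in> U \<Longrightarrow> q t \<eta> \<le> \<kappa> t"
      "t \<in> {A..B} \<Longrightarrow> \<eta> \<in> U \<Longrightarrow> \<bar>b t \<eta>\<bar> \<le> l t" "t \<in> {A..B} \<Longrightarrow> \<eta> \<in> U \<Longrightarrow> \<bar>f t \<eta>\<bar> \<le> \<phi> t"
    and q_pos: "negligible {t \<in> {A..B}. \<exists>\<eta>\<in>U. q t \<eta> = 0}"
begin

section \<open>The right-hand side of the equation and its family of solutions\<close>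

text \<open>Right-hand side of the first-order equation for \<open>v = V'\<close>: for each control
  the equation is solved for \<open>v'\<close>, and the smallest result is taken.\<close>

definition G :: "real \<Rightarrow> real \<Rightarrow> real \<Rightarrow> real" where
  "G \<alpha> t y = (INF \<eta>\<in>U. \<alpha> * q t \<eta> - b t \<eta> * y - f t \<eta>)"

text \<open>A lower bound, independent of the state \<open>y\<close>, for the rate at which
  \<open>G\<close> grows with \<alpha>.\<close>

definition m :: "real \<Rightarrow> real" where
  "m t = (INF \<eta>\<in>U. q t \<eta>)"

lemma cont_G: "t \<in> {A..B} \<Longrightarrow> continuous_on U (\<lambda>\<eta>. \<alpha> * q t \<eta> - b t \<eta> * y - f t \<eta>)"
  by (intro continuous_intros cont)

lemma G_attained:
  assumes "t \<in> {A..B}"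
  shows "\<exists>\<eta>\<in>U. G \<alpha> t y = \<alpha> * q t \<eta> - b t \<eta> * y - f t \<eta>"
    and "\<eta> \<in> U \<Longrightarrow> G \<alpha> t y \<le> \<alpha> * q t \<eta> - b t \<eta> * y - f t \<eta>"
  by (rule INF_compact_attained[OF U cont_G[OF assms, of \<alpha> y]]; force simp: G_def)+

lemma m_attained:
  assumes "t \<in> {A..B}"
  shows "\<exists>\<eta>\<in>U. m t = q t \<eta>"
    and "\<eta> \<in> U \<Longrightarrow> m t \<le> q t \<eta>"
  by (rule INF_compact_attained[OF U cont(1)[OF assms]]; force simp: m_def)+

lemma l_nonneg: "t \<in> {A..B} \<Longrightarrow> 0 \<le> l t"
  using bounds(3)[of t] U(2) by fastforce

lemma \<kappa>_nonneg: "t \<in> {A..B} \<Longrightarrow> 0 \<le> \<kappa> t"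
  using bounds(1,2)[of t] U(2) by fastforce

lemma m_bounds: "t \<in> {A..B} \<Longrightarrow> 0 \<le> m t \<and> m t \<le> \<kappa> t"
  using m_attained(1)[of t] bounds(1,2)[of t] by force

text \<open>A minimiser of one infimum is a competitor in the other: the minimiser at
  \<open>(\<beta>, z)\<close> gives the lower bound, the one at \<open>(\<alpha>, y)\<close> the
  upper bound.\<close>

lemma G_diff:
  assumes t: "t \<in> {A..B}" and le: "\<alpha> \<le> \<beta>"
  shows "(\<beta> - \<alpha>) * m t - l t * \<bar>z - y\<bar> \<le> G \<beta> t z - G \<alpha> t y"
    "G \<beta> t z - G \<alpha> t y \<le> (\<beta> - \<alpha>) * \<kappa> t + l t * \<bar>z - y\<bar>"
proof -
  have b: "\<bar>b t \<xi> * (z - y)\<bar> \<le> l t * \<bar>z - y\<bar>" if "\<xi> \<in> U" for \<xi>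
    unfolding abs_mult using bounds(3)[OF t that] by (intro mult_right_mono) auto
  obtain \<eta> where \<eta>: "\<eta> \<in> U" "G \<beta> t z = \<beta> * q t \<eta> - b t \<eta> * z - f t \<eta>"
    using G_attained(1)[OF t, of \<beta> z] by blast
  have "G \<alpha> t y \<le> \<alpha> * q t \<eta> - b t \<eta> * y - f t \<eta>"
    by (rule G_attained(2)[OF t \<eta>(1)])
  moreover have "(\<beta> - \<alpha>) * m t \<le> (\<beta> - \<alpha>) * q t \<eta>"
    using m_attained(2)[OF t \<eta>(1)] le by (intro mult_left_mono) auto
  ultimately show "(\<beta> - \<alpha>) * m t - l t * \<bar>z - y\<bar> \<le> G \<beta> t z - G \<alpha> t y"
    using b[OF \<eta>(1)] \<eta>(2) by (simp add: algebra_simps abs_le_iff)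
  obtain \<eta>' where \<eta>': "\<eta>' \<in> U" "G \<alpha> t y = \<alpha> * q t \<eta>' - b t \<eta>' * y - f t \<eta>'"
    using G_attained(1)[OF t, of \<alpha> y] by blast
  have "G \<beta> t z \<le> \<beta> * q t \<eta>' - b t \<eta>' * z - f t \<eta>'"
    by (rule G_attained(2)[OF t \<eta>'(1)])
  moreover have "(\<beta> - \<alpha>) * q t \<eta>' \<le> (\<beta> - \<alpha>) * \<kappa> t"
    using bounds(2)[OF t \<eta>'(1)] le by (intro mult_left_mono) auto
  ultimately show "G \<beta> t z - G \<alpha> t y \<le> (\<beta> - \<alpha>) * \<kappa> t + l t * \<bar>z - y\<bar>"
    using b[OF \<eta>'(1)] \<eta>'(2) by (simp add: algebra_simps abs_le_iff)
qed

lemma G_lipschitz: "t \<in> {A..B} \<Longrightarrow> \<bar>G \<alpha> t z - G \<alpha> t y\<bar> \<le> l t * \<bar>z - y\<bar>"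
  using G_diff[of t \<alpha> \<alpha> z y] by auto

lemma G_bound:
  assumes t: "t \<in> {A..B}"
  shows "\<bar>G \<alpha> t y\<bar> \<le> \<bar>\<alpha>\<bar> * \<kappa> t + l t * \<bar>y\<bar> + \<phi> t"
proof -
  obtain \<eta> where \<eta>: "\<eta> \<in> U" "G \<alpha> t y = \<alpha> * q t \<eta> - b t \<eta> * y - f t \<eta>"
    using G_attained(1)[OF t, of \<alpha> y] by blast
  have "\<bar>\<alpha> * q t \<eta>\<bar> \<le> \<bar>\<alpha>\<bar> * \<kappa> t" "\<bar>b t \<eta> * y\<bar> \<le> l t * \<bar>y\<bar>"
    unfolding abs_mult using bounds[OF t \<eta>(1)] by (auto intro!: mult_left_mono mult_right_mono)
  then show ?thesis using \<eta>(2) bounds(4)[OF t \<eta>(1)] by linarith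
qed

lemma m_integrable: "m absolutely_integrable_on {A..B}"
proof (rule measurable_bounded_by_integrable_imp_absolutely_integrable)
  show "m \<in> borel_measurable (lebesgue_on {A..B})"
    unfolding m_def[abs_def] using U meas cont by (intro borel_measurable_INF_compact) auto
  show "\<kappa> integrable_on {A..B}" using int by (auto simp: absolutely_integrable_on_def)
  show "norm (m t) \<le> \<kappa> t" if "t \<in> {A..B}" for t
    using m_bounds[OF that] by simp
qed simp

text \<open>Measurability is checked for each fixed control, and \<open>G_bound\<close> gives an
  integrable majorant because \<open>w\<close> is continuous.\<close>

lemma G_integrable:
  assumes w: "continuous_on {A..B} w"
  shows "(\<lambda>t. G \<alpha> t (w t)) absolutely_integrable_on {A..B}"
proof (rule measurable_bounded_by_integrable_imp_absolutely_integrable)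
  have [measurable]: "w \<in> borel_measurable (lebesgue_on {A..B})"
    by (rule continuous_imp_measurable_on_sets_lebesgue[OF w]) simp
  have "(\<lambda>t. \<alpha> * q t \<eta> - b t \<eta> * w t - f t \<eta>) \<in> borel_measurable (lebesgue_on {A..B})" if "\<eta> \<in> U" for \<eta>
    using meas[OF that] by measurable
  then show "(\<lambda>t. G \<alpha> t (w t)) \<in> borel_measurable (lebesgue_on {A..B})"
    unfolding G_def using U cont_G by (intro borel_measurable_INF_compact) auto
  have "(\<lambda>t. l t * \<bar>w t\<bar>) absolutely_integrable_on {A..B}"
    by (intro absolutely_integrable_mult_continuous int continuous_intros w)
  then show "(\<lambda>t. \<bar>\<alpha>\<bar> * \<kappa> t + l t * \<bar>w t\<bar> + \<phi> t) integrable_on {A..B}"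
    using int by (auto simp: absolutely_integrable_on_def intro!: integrable_add integrable_on_mult_right)
  show "norm (G \<alpha> t (w t)) \<le> \<bar>\<alpha>\<bar> * \<kappa> t + l t * \<bar>w t\<bar> + \<phi> t" if "t \<in> {A..B}" for t
    using G_bound[OF that] by simp
qed simp

text \<open>\<open>p\<close> and \<open>C\<close> are explicit Gronwall bounds. The difference
  \<open>v \<beta> - v \<alpha>\<close> is an indefinite integral whose integrand is controlled by
  \<open>G_diff\<close>, with sources \<open>(\<beta> - \<alpha>) * m t\<close> from below and
  \<open>(\<beta> - \<alpha>) * \<kappa> t\<close> from above.\<close>

lemma solution_family:
  obtains v p C where
    "\<And>\<alpha>. continuous_on {A..B} (v \<alpha>)"
    "\<And>\<alpha> x. x \<in> {A..B} \<Longrightarrow> v \<alpha> x = integral {A..x} (\<lambda>t. G \<alpha> t (v \<alpha> t))"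
    "continuous_on {A..B} p" "\<And>x. x \<in> {A..B} \<Longrightarrow> 0 \<le> p x"
    "\<And>x. x \<in> {A<..B} \<Longrightarrow> 0 < p x"
    "\<And>\<alpha> \<beta> x. \<alpha> \<le> \<beta> \<Longrightarrow> x \<in> {A..B} \<Longrightarrow> (\<beta> - \<alpha>) * p x \<le> v \<beta> x - v \<alpha> x"
    "\<And>\<alpha> \<beta> x. \<alpha> \<le> \<beta> \<Longrightarrow> x \<in> {A..B} \<Longrightarrow> v \<beta> x - v \<alpha> x \<le> (\<beta> - \<alpha>) * C"
proof -
  have "\<exists>v. continuous_on {A..B} v \<and> (\<forall>x\<in>{A..B}. v x = integral {A..x} (\<lambda>t. G \<alpha> t (v t)))" for \<alpha>
    by (rule caratheodory_solution[OF less_imp_le[OF AB] int(2) l_nonneg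
        G_integrable[where \<alpha> = \<alpha>] G_lipschitz[where \<alpha> = \<alpha>]]) auto
  then have "\<forall>\<alpha>. \<exists>v. continuous_on {A..B} v \<and> (\<forall>x\<in>{A..B}. v x = integral {A..x} (\<lambda>t. G \<alpha> t (v t)))"
    by blast
  from choice[OF this] obtain v where v: "\<And>\<alpha>. continuous_on {A..B} (v \<alpha>)"
    "\<And>\<alpha> x. x \<in> {A..B} \<Longrightarrow> v \<alpha> x = integral {A..x} (\<lambda>t. G \<alpha> t (v \<alpha> t))" by blast
  define M where "M = integral {A..B} l"
  define p where "p x = exp (- 2 * M) * integral {A..x} m" for x
  define C where "C = exp (2 * M) * integral {A..B} \<kappa>"
  have mi: "m integrable_on {A..B}" using m_integrable by (auto simp: absolutely_integrable_on_def)
  have subi: "h integrable_on {A..x}" if "x \<in> {A..B}" "h absolutely_integrable_on {A..B}" for x and h :: "real \<Rightarrow> real"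
    using absolutely_integrable_on_subinterval[OF that(2), of A x] that(1)
    by (intro set_lebesgue_integral_eq_integral(1)) simp
  show ?thesis
  proof (rule that[of v p C])
    show "continuous_on {A..B} (v \<alpha>)" for \<alpha> by (rule v(1))
    show "v \<alpha> x = integral {A..x} (\<lambda>t. G \<alpha> t (v \<alpha> t))" if "x \<in> {A..B}" for \<alpha> x
      using that by (rule v(2))
    show "continuous_on {A..B} p" unfolding p_def[abs_def]
      by (intro continuous_intros continuous_on_indefinite_integral mi)
    show "0 \<le> p x" if "x \<in> {A..B}" for x
      unfolding p_def using subi[OF that m_integrable] m_bounds that
      by (intro mult_nonneg_nonneg Henstock_Kurzweil_Integration.integral_nonneg) auto
    show "0 < p x" if x: "x \<in> {A<..B}" for x
    proof -
      have "0 < integral {A..x} m"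
      proof (rule integral_pos_of_ae_pos)
        show "m absolutely_integrable_on {A..x}"
          using absolutely_integrable_on_subinterval[OF m_integrable, of A x] x by auto
        show "A < x" using x by auto
        show "0 \<le> m t" if "t \<in> {A..x}" for t using m_bounds[of t] x that by auto
        \<comment> \<open>The infimum \<open>m t\<close> is attained, so its vanishing puts
          \<open>t\<close> into the null set of \<open>q_pos\<close>.\<close>
        show "negligible {t \<in> {A..x}. m t = 0}"
        proof (rule negligible_subset[OF q_pos], safe)
          fix t assume t: "t \<in> {A..x}" "m t = 0"
          then show "t \<in> {A..B}" using x by auto
          then show "\<exists>\<eta>\<in>U. q t \<eta> = 0" using m_attained(1)[of t] t(2) by auto
        qed
      qed
      then show ?thesis by (simp add: p_def)
    qed
    fix \<alpha> \<beta> x :: real assume le: "\<alpha> \<le> \<beta>" and x: "x \<in> {A..B}"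
    define d where "d y = v \<beta> y - v \<alpha> y" for y
    define g where "g t = G \<beta> t (v \<beta> t) - G \<alpha> t (v \<alpha> t)" for t
    have g: "g absolutely_integrable_on {A..B}"
      unfolding g_def[abs_def] by (intro set_integral_diff G_integrable v)
    have d: "d y = integral {A..y} g" if "y \<in> {A..B}" for y
      unfolding d_def g_def v(2)[OF that]
      by (intro Henstock_Kurzweil_Integration.integral_diff[symmetric] subi that G_integrable v)
    have k: "(\<lambda>t. (\<beta> - \<alpha>) * h t) absolutely_integrable_on {A..B}" if "h absolutely_integrable_on {A..B}" for h :: "real \<Rightarrow> real"
      using that by (simp add: set_integrable_mult_right)
    have "exp (- 2 * M) * integral {A..x} (\<lambda>t. (\<beta> - \<alpha>) * m t) \<le> d x"
      unfolding M_def
    proof (rule gronwall_lower[OF int(2) l_nonneg g k[OF m_integrable] _ d x])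
      fix t assume t: "t \<in> {A..B}"
      show "0 \<le> (\<beta> - \<alpha>) * m t" using m_bounds[OF t] le by simp
      show "(\<beta> - \<alpha>) * m t - l t * \<bar>d t\<bar> \<le> g t" unfolding g_def d_def by (rule G_diff(1)[OF t le])
    qed
    then show "(\<beta> - \<alpha>) * p x \<le> v \<beta> x - v \<alpha> x" by (simp add: p_def d_def mult_ac)
    have "d x \<le> exp (2 * M) * integral {A..x} (\<lambda>t. (\<beta> - \<alpha>) * \<kappa> t)"
      unfolding M_def
    proof (rule gronwall_upper[OF int(2) l_nonneg g k[OF int(1)] _ d x])
      fix t assume t: "t \<in> {A..B}"
      show "0 \<le> (\<beta> - \<alpha>) * \<kappa> t" using \<kappa>_nonneg[OF t] le by simp
      show "g t \<le> (\<beta> - \<alpha>) * \<kappa> t + l t * \<bar>d t\<bar>" unfolding g_def d_def by (rule G_diff(2)[OF t le])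
    qed
    also have "\<dots> = (\<beta> - \<alpha>) * (exp (2 * M) * integral {A..x} \<kappa>)" by (simp add: mult_ac)
    also have "\<dots> \<le> (\<beta> - \<alpha>) * C"
      unfolding C_def
    proof (intro mult_left_mono integral_subset_le)
      show "\<kappa> integrable_on {A..x}" "\<kappa> integrable_on {A..B}"
        using subi[OF x int(1)] subi[OF _ int(1), of B] AB by auto
    qed (use le x \<kappa>_nonneg in auto)
    finally show "v \<beta> x - v \<alpha> x \<le> (\<beta> - \<alpha>) * C" by (simp add: d_def)
  qed
qed

end

section \<open>The nonlocal boundary condition\<close>

lemma set_integrable_lborel_imp_lebesgue:
  fixes h :: "'a::euclidean_space \<Rightarrow> real"
  assumes "set_integrable lborel S h"
  shows "h absolutely_integrable_on S"
  using assms unfolding set_integrable_def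
  by (subst integrable_completion) (auto dest: borel_measurable_integrable)

text \<open>For each control the expression is increasing in \<open>w\<close> and equals \<alpha>
  when \<open>w\<close> is \<open>?h \<eta>\<close>. At the minimum of \<open>?h\<close> it is
  therefore at most \<alpha>, with equality at the minimiser.\<close>

lemma eq_SUP_of_eq_INF:
  fixes s \<mu> f :: "'u::topological_space \<Rightarrow> real"
  assumes U: "compact U" "U \<noteq> {}" and s: "\<And>\<eta>. \<eta> \<in> U \<Longrightarrow> 0 < s \<eta>"
    and c: "continuous_on U s" "continuous_on U \<mu>" "continuous_on U f"
    and w: "w = (INF \<eta>\<in>U. \<alpha> * (2 / (s \<eta>)\<^sup>2) - 2 * \<mu> \<eta> / (s \<eta>)\<^sup>2 * y - 2 * f \<eta> / (s \<eta>)\<^sup>2)"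
  shows "\<alpha> = (SUP \<eta>\<in>U. 1 / 2 * (s \<eta>)\<^sup>2 * w + \<mu> \<eta> * y + f \<eta>)"
proof -
  let ?h = "\<lambda>\<eta>. \<alpha> * (2 / (s \<eta>)\<^sup>2) - 2 * \<mu> \<eta> / (s \<eta>)\<^sup>2 * y - 2 * f \<eta> / (s \<eta>)\<^sup>2"
  have s0: "\<forall>\<eta>\<in>U. (s \<eta>)\<^sup>2 \<noteq> 0" using s by fastforce
  have "continuous_on U ?h"
    using s0 by (intro continuous_intros c)
  then obtain \<eta>\<^sub>0 where \<eta>: "\<eta>\<^sub>0 \<in> U" "w = ?h \<eta>\<^sub>0" "\<And>\<xi>. \<xi> \<in> U \<Longrightarrow> ?h \<eta>\<^sub>0 \<le> ?h \<xi>"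
    using INF_compact_attained[OF U, of ?h] unfolding w by blast
  have e: "1 / 2 * (s \<eta>)\<^sup>2 * ?h \<eta> + \<mu> \<eta> * y + f \<eta> = \<alpha>" if "\<eta> \<in> U" for \<eta>
    using s[OF that] by (simp add: field_simps)
  have "1 / 2 * (s \<eta>)\<^sup>2 * w + \<mu> \<eta> * y + f \<eta> \<le> \<alpha>" if "\<eta> \<in> U" for \<eta>
  proof -
    have "1 / 2 * (s \<eta>)\<^sup>2 * w \<le> 1 / 2 * (s \<eta>)\<^sup>2 * ?h \<eta>"
      using \<eta>(2) \<eta>(3)[OF that] by (intro mult_left_mono) auto
    then show ?thesis using e[OF that] by linarith
  qed
  moreover have "1 / 2 * (s \<eta>\<^sub>0)\<^sup>2 * w + \<mu> \<eta>\<^sub>0 * y + f \<eta>\<^sub>0 = \<alpha>"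
    unfolding \<eta>(2) by (rule e[OF \<eta>(1)])
  ultimately show ?thesis
    using \<eta>(1) by (intro cSup_eq_maximum[symmetric]) force+
qed

text \<open>For the primitive \<open>V\<close> of \<open>v\<close> the condition says that the mean
  of \<open>V B - V x\<close> under \<nu> is \<open>- P\<close>. As a function \<Phi> of \<alpha>
  this mean has a positive lower and a finite upper slope bound, so it takes every value.\<close>

lemma (in hjb_data) boundary_solution:
  fixes \<nu> :: "real measure" and P :: real
  assumes \<nu>: "prob_space \<nu>" and sets: "sets \<nu> = sets (restrict_space borel {A..<B})"
  obtains \<alpha> v where "continuous_on {A..B} v"
    "\<And>x. x \<in> {A..B} \<Longrightarrow> v x = integral {A..x} (\<lambda>t. G \<alpha> t (v t))"
    "integral {A..B} v + P = (LINT x|\<nu>. integral {A..x} v)"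
proof -
  interpret prob_space \<nu> by (rule \<nu>)
  obtain v p C where v: "\<And>\<alpha>. continuous_on {A..B} (v \<alpha>)"
    "\<And>\<alpha> x. x \<in> {A..B} \<Longrightarrow> v \<alpha> x = integral {A..x} (\<lambda>t. G \<alpha> t (v \<alpha> t))"
    and p: "continuous_on {A..B} p" "\<And>x. x \<in> {A..B} \<Longrightarrow> 0 \<le> p x" "\<And>x. x \<in> {A<..B} \<Longrightarrow> 0 < p x"
    and lo: "\<And>\<alpha> \<beta> x. \<alpha> \<le> \<beta> \<Longrightarrow> x \<in> {A..B} \<Longrightarrow> (\<beta> - \<alpha>) * p x \<le> v \<beta> x - v \<alpha> x"
    and hi: "\<And>\<alpha> \<beta> x. \<alpha> \<le> \<beta> \<Longrightarrow> x \<in> {A..B} \<Longrightarrow> v \<beta> x - v \<alpha> x \<le> (\<beta> - \<alpha>) * C"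
    by (rule solution_family) blast
  have space: "space \<nu> = {A..<B}"
    using sets_eq_imp_space_eq[OF sets] by (simp add: space_restrict_space)
  have int_\<nu>: "integrable \<nu> h" if "continuous_on {A..B} h" for h :: "real \<Rightarrow> real"
  proof -
    have "bounded (h ` {A..B})" using that by (simp add: compact_continuous_image compact_imp_bounded)
    then obtain K where K: "\<And>x. x \<in> {A..B} \<Longrightarrow> norm (h x) \<le> K"
      unfolding bounded_iff by blast
    have "h \<in> borel_measurable (restrict_space borel {A..<B})"
      using that by (intro borel_measurable_continuous_on_restrict) (auto intro: continuous_on_subset)
    then have "h \<in> borel_measurable \<nu>" by (simp cong: measurable_cong_sets add: sets)
    moreover have "AE x in \<nu>. norm (h x) \<le> K" using K space by (intro AE_I2) auto
    ultimately show ?thesis by (intro integrable_const_bound)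
  qed
  have cI: "continuous_on {A..B} (\<lambda>x. integral {A..B} h - integral {A..x} h)"
    if "continuous_on {A..B} h" for h :: "real \<Rightarrow> real"
    using integrable_continuous_real[OF that] by (intro continuous_intros continuous_on_indefinite_integral)
  \<comment> \<open>The increment of the primitive from \<open>x\<close> to \<open>B\<close>.
    Writing it with integrals that start at \<open>A\<close> gives continuity in \<open>x\<close>,
    hence integrability under \<nu>.\<close>
  define R where "R h x = integral {A..B} h - integral {A..x} h" for h :: "real \<Rightarrow> real" and x
  have R: "R h x = integral {x..B} h" if "continuous_on {A..B} h" "x \<in> {A..B}" for h x
    unfolding R_def using integral_sub_eq[OF integrable_continuous_real[OF that(1)], of x B] that(2) by auto
  have R_int: "integrable \<nu> (R h)" if "continuous_on {A..B} h" for h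
    unfolding R_def[abs_def] by (rule int_\<nu>[OF cI[OF that]])
  define \<Phi> where "\<Phi> \<alpha> = (LINT x|\<nu>. R (v \<alpha>) x)" for \<alpha>
  have diff: "\<Phi> \<beta> - \<Phi> \<alpha> = (LINT x|\<nu>. R (v \<beta>) x - R (v \<alpha>) x)" for \<alpha> \<beta>
    unfolding \<Phi>_def by (intro Bochner_Integration.integral_diff[symmetric] R_int v)
  have slope: "(\<beta> - \<alpha>) * R p x \<le> R (v \<beta>) x - R (v \<alpha>) x"
    "R (v \<beta>) x - R (v \<alpha>) x \<le> (\<beta> - \<alpha>) * R (\<lambda>_. C) x"
    if le: "\<alpha> \<le> \<beta>" and x: "x \<in> {A..B}" for \<alpha> \<beta> x
  proof -
    have ii: "h integrable_on {x..B}" if "continuous_on {A..B} h" for h :: "real \<Rightarrow> real"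
      using continuous_on_subset[OF that, of "{x..B}"] x by (intro integrable_continuous_real) auto
    have d: "R (v \<beta>) x - R (v \<alpha>) x = integral {x..B} (\<lambda>t. v \<beta> t - v \<alpha> t)"
      unfolding R[OF v(1) x] by (intro Henstock_Kurzweil_Integration.integral_diff[symmetric] ii v(1))
    have "(\<beta> - \<alpha>) * R p x = integral {x..B} (\<lambda>t. (\<beta> - \<alpha>) * p t)"
      unfolding R[OF p(1) x] by simp
    also have "\<dots> \<le> integral {x..B} (\<lambda>t. v \<beta> t - v \<alpha> t)"
    proof (rule integral_le)
      show "(\<beta> - \<alpha>) * p t \<le> v \<beta> t - v \<alpha> t" if "t \<in> {x..B}" for t using lo[OF le, of t] that x by auto
    qed (intro ii continuous_intros v(1) p(1))+
    finally show "(\<beta> - \<alpha>) * R p x \<le> R (v \<beta>) x - R (v \<alpha>) x" using d by simp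
    have "integral {x..B} (\<lambda>t. v \<beta> t - v \<alpha> t) \<le> integral {x..B} (\<lambda>t. (\<beta> - \<alpha>) * C)"
    proof (rule integral_le)
      show "v \<beta> t - v \<alpha> t \<le> (\<beta> - \<alpha>) * C" if "t \<in> {x..B}" for t using hi[OF le, of t] that x by auto
    qed (intro ii continuous_intros v(1))+
    also have "\<dots> = (\<beta> - \<alpha>) * R (\<lambda>_. C) x"
      by (subst R[OF _ x]) (simp_all only: continuous_on_const integral_mult_right)
    finally show "R (v \<beta>) x - R (v \<alpha>) x \<le> (\<beta> - \<alpha>) * R (\<lambda>_. C) x" using d by simp
  qed
  \<comment> \<open>\<open>p\<close> vanishes at most at \<open>A\<close>, and \<open>x < B\<close>
    leaves an interval of positive length.\<close>
  have pos: "0 < R p x" if x: "x \<in> {A..<B}" for x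
  proof -
    have "0 < integral {x..B} p"
    proof (rule integral_pos_of_ae_pos)
      show "p absolutely_integrable_on {x..B}"
        using continuous_on_subset[OF p(1), of "{x..B}"] x by (intro absolutely_integrable_continuous_real) auto
      show "0 \<le> p t" if "t \<in> {x..B}" for t using p(2) x that by auto
      show "negligible {t \<in> {x..B}. p t = 0}"
        by (rule negligible_subset[of "{A}"]) (use p(3) x in \<open>force+\<close>)
    qed (use x in auto)
    then show ?thesis using R[OF p(1), of x] x by auto
  qed
  have "AE x in \<nu>. 0 < R p x" using pos space by (intro AE_I2) simp
  \<comment> \<open>The absence of \<open>B\<close> from the space of \<nu> matters here:
    \<open>R p B\<close> is \<open>0\<close>, whereas \<open>R p\<close> is positive at every point
    below \<open>B\<close>, and so is its mean.\<close>
  then have c: "0 < (LINT x|\<nu>. R p x)"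
    using integral_less_AE_space[of "\<lambda>_. 0" "R p"] R_int[OF p(1)] by (simp add: emeasure_space_1)
  obtain \<alpha> where \<alpha>: "\<Phi> \<alpha> = - P"
  proof (rule surj_of_slope_bounds[OF c, of \<Phi> "LINT x|\<nu>. R (\<lambda>_. C) x"])
    fix \<alpha> \<beta> :: real assume le: "\<alpha> \<le> \<beta>"
    have "(LINT x|\<nu>. (\<beta> - \<alpha>) * R p x) \<le> \<Phi> \<beta> - \<Phi> \<alpha>"
      unfolding diff
      by (intro integral_mono integrable_mult_right Bochner_Integration.integrable_diff R_int v(1) p(1) slope[OF le])
        (simp add: space)
    then show "(LINT x|\<nu>. R p x) * (\<beta> - \<alpha>) \<le> \<Phi> \<beta> - \<Phi> \<alpha>" by (simp add: mult.commute)
    have "\<Phi> \<beta> - \<Phi> \<alpha> \<le> (LINT x|\<nu>. (\<beta> - \<alpha>) * R (\<lambda>_. C) x)"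
      unfolding diff
      by (intro integral_mono integrable_mult_right Bochner_Integration.integrable_diff R_int v(1)
          continuous_on_const slope[OF le]) (simp add: space)
    then show "\<Phi> \<beta> - \<Phi> \<alpha> \<le> (LINT x|\<nu>. R (\<lambda>_. C) x) * (\<beta> - \<alpha>)" by (simp add: mult.commute)
  qed
  show ?thesis
  proof (rule that[of "v \<alpha>" \<alpha>])
    show "continuous_on {A..B} (v \<alpha>)" by (rule v)
    show "v \<alpha> x = integral {A..x} (\<lambda>t. G \<alpha> t (v \<alpha> t))" if "x \<in> {A..B}" for x using that by (rule v(2))
    have "integrable \<nu> (\<lambda>x. integral {A..x} (v \<alpha>))"
      by (intro int_\<nu> continuous_on_indefinite_integral integrable_continuous_real v)
    then have "\<Phi> \<alpha> = integral {A..B} (v \<alpha>) - (LINT x|\<nu>. integral {A..x} (v \<alpha>))"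
      unfolding \<Phi>_def R_def by (simp add: prob_space)
    then show "integral {A..B} (v \<alpha>) + P = (LINT x|\<nu>. integral {A..x} (v \<alpha>))" using \<alpha> by simp
  qed
qed

theorem theorem7:
  fixes A B P\<^sub>B :: real
    and U :: "'u::metric_space set"
    and \<mu> \<sigma> f :: "real \<Rightarrow> 'u \<Rightarrow> real"
    and \<Lambda> \<zeta> F :: "real \<Rightarrow> real"
    and \<nu>\<^sub>B :: "real measure"
  assumes "A \<le> 0" and "0 < B"
    and "compact U" and "U \<noteq> {}"
    and "\<forall>x\<in>{A..B}. \<forall>\<eta>\<in>U. 0 < \<sigma> x \<eta>"
    and "(\<lambda>(x, \<eta>). \<mu> x \<eta>) \<in> borel_measurable (restrict_space borel ({A..B} \<times> U))"
    and "(\<lambda>(x, \<eta>). \<sigma> x \<eta>) \<in> borel_measurable (restrict_space borel ({A..B} \<times> U))"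
    and "(\<lambda>(x, \<eta>). f x \<eta>) \<in> borel_measurable (restrict_space borel ({A..B} \<times> U))"
    and "\<forall>x\<in>{A..B}. continuous_on U (\<mu> x) \<and> continuous_on U (\<sigma> x) \<and> continuous_on U (f x)"
    and "\<forall>\<eta>\<in>U. (\<lambda>x. \<mu> x \<eta>) \<in> borel_measurable (restrict_space borel {A..B})
           \<and> (\<lambda>x. \<sigma> x \<eta>) \<in> borel_measurable (restrict_space borel {A..B})
           \<and> (\<lambda>x. f x \<eta>) \<in> borel_measurable (restrict_space borel {A..B})"
    and "\<forall>x\<in>{A..B}. 0 < \<Lambda> x \<and> 0 < \<zeta> x \<and> 0 < F x"
    and "\<Lambda> \<in> borel_measurable (restrict_space borel {A..B})"
    and "\<zeta> \<in> borel_measurable (restrict_space borel {A..B})"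
    and "F \<in> borel_measurable (restrict_space borel {A..B})"
    and "AE x in lborel. x \<in> {A<..<B} \<longrightarrow>
           (\<forall>\<eta>\<in>U. \<Lambda> x \<ge> \<bar>\<mu> x \<eta>\<bar> / (\<sigma> x \<eta>)\<^sup>2
                 \<and> F x \<ge> \<bar>f x \<eta>\<bar> / (\<sigma> x \<eta>)\<^sup>2
                 \<and> \<zeta> x \<le> (\<sigma> x \<eta>)\<^sup>2)"
    and "set_integrable lborel {A..B} \<Lambda>"
    and "set_integrable lborel {A..B} F"
    and "set_integrable lborel {A..B} (\<lambda>x. 1 / \<zeta> x)"
    and "prob_space \<nu>\<^sub>B" and "sets \<nu>\<^sub>B = sets (restrict_space borel {A..<B})"
  shows "\<exists>(\<alpha>::real) V. V \<in> W21 A B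
     \<and> (AE x in lborel. x \<in> {A<..<B} \<longrightarrow>
          interval_deriv A B V differentiable (at x) \<and>
          \<alpha> = (SUP \<eta>\<in>U. 1 / 2 * (\<sigma> x \<eta>)\<^sup>2 * interval_deriv A B (interval_deriv A B V) x
                     + \<mu> x \<eta> * interval_deriv A B V x + f x \<eta>))
     \<and> V B + P\<^sub>B = (LINT x|\<nu>\<^sub>B. V x)
     \<and> interval_deriv A B V A = 0"
proof -

  \<comment> \<open>Reduction to coefficients with bounds valid everywhere\<close>
  note spos = assms(5) and cont_\<eta> = assms(9) and meas = assms(10) and pos = assms(11) and ae = assms(15)
  have AB: "A < B" using assms(1,2) by simp
  obtain N where N: "N \<in> null_sets lborel" and Nsub: "{x \<in> space lborel. \<not> (x \<in> {A<..<B} \<longrightarrow>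
           (\<forall>\<eta>\<in>U. \<Lambda> x \<ge> \<bar>\<mu> x \<eta>\<bar> / (\<sigma> x \<eta>)\<^sup>2 \<and> F x \<ge> \<bar>f x \<eta>\<bar> / (\<sigma> x \<eta>)\<^sup>2 \<and> \<zeta> x \<le> (\<sigma> x \<eta>)\<^sup>2))} \<subseteq> N"
    using ae unfolding eventually_ae_filter by blast
  have Nneg: "negligible N"
    using null_sets_completionI[OF N] by (simp add: negligible_iff_null_sets)
  \<comment> \<open>On \<open>H\<close> the bounds hold for all controls at once; its complement in
    the interval lies in \<open>N\<close> and the two endpoints.\<close>
  define H where "H = {A<..<B} - N"
  have Hm: "H \<in> sets lebesgue" using N unfolding H_def by (auto dest: null_setsD2 intro!: sets_completionI_sets)
  have HAB: "x \<in> {A..B}" if "x \<in> H" for x using that by (auto simp: H_def)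
  have HB: "\<bar>\<mu> x \<eta>\<bar> / (\<sigma> x \<eta>)\<^sup>2 \<le> \<Lambda> x" "\<bar>f x \<eta>\<bar> / (\<sigma> x \<eta>)\<^sup>2 \<le> F x" "\<zeta> x \<le> (\<sigma> x \<eta>)\<^sup>2"
    if "x \<in> H" "\<eta> \<in> U" for x \<eta>
    using Nsub that by (auto simp: H_def)
  \<comment> \<open>The value \<open>0\<close> off \<open>H\<close> makes the bounds hold at every
    point of \<open>{A..B}\<close>, while continuity in \<eta> and measurability in \<open>t\<close>
    persist.\<close>
  define q where "q t \<eta> = (if t \<in> H then 2 / (\<sigma> t \<eta>)\<^sup>2 else 0)" for t \<eta>
  define b where "b t \<eta> = (if t \<in> H then 2 * \<mu> t \<eta> / (\<sigma> t \<eta>)\<^sup>2 else 0)" for t \<eta>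
  define h where "h t \<eta> = (if t \<in> H then 2 * f t \<eta> / (\<sigma> t \<eta>)\<^sup>2 else 0)" for t \<eta>
  have s0: "\<forall>\<eta>\<in>U. (\<sigma> t \<eta>)\<^sup>2 \<noteq> 0" if "t \<in> {A..B}" for t using spos that by fastforce
  have [measurable]: "{x \<in> space (lebesgue_on {A..B}). x \<in> H} \<in> sets (lebesgue_on {A..B})"
  proof -
    have "{x \<in> space (lebesgue_on {A..B}). x \<in> H} = {A..B} \<inter> H" by auto
    then show ?thesis using Hm by (auto simp: sets_restrict_space)
  qed
  interpret hjb_data A B U q b h "\<lambda>t. 2 * (1 / \<zeta> t)" "\<lambda>t. 2 * \<Lambda> t" "\<lambda>t. 2 * F t"
  proof
    show "A < B" by (rule AB)
    show "compact U" "U \<noteq> {}" by (rule assms)+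
    show "continuous_on U (q t)" if "t \<in> {A..B}" for t
      unfolding q_def[abs_def] using cont_\<eta> s0 that by (cases "t \<in> H") (auto intro!: continuous_intros)
    show "continuous_on U (b t)" if "t \<in> {A..B}" for t
      unfolding b_def[abs_def] using cont_\<eta> s0 that by (cases "t \<in> H") (auto intro!: continuous_intros)
    show "continuous_on U (h t)" if "t \<in> {A..B}" for t
      unfolding h_def[abs_def] using cont_\<eta> s0 that by (cases "t \<in> H") (auto intro!: continuous_intros)
    fix \<eta> assume \<eta>: "\<eta> \<in> U"
    have [measurable]: "(\<lambda>t. \<sigma> t \<eta>) \<in> borel_measurable (lebesgue_on {A..B})"
      "(\<lambda>t. \<mu> t \<eta>) \<in> borel_measurable (lebesgue_on {A..B})"
      "(\<lambda>t. f t \<eta>) \<in> borel_measurable (lebesgue_on {A..B})"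
      using meas \<eta> by (auto intro: borel_measurable_lebesgue_onI)
    show "(\<lambda>t. q t \<eta>) \<in> borel_measurable (lebesgue_on {A..B})" unfolding q_def by (intro measurable_If) measurable
    show "(\<lambda>t. b t \<eta>) \<in> borel_measurable (lebesgue_on {A..B})" unfolding b_def by (intro measurable_If) measurable
    show "(\<lambda>t. h t \<eta>) \<in> borel_measurable (lebesgue_on {A..B})" unfolding h_def by (intro measurable_If) measurable
    fix t assume t: "t \<in> {A..B}"
    have p: "0 < \<Lambda> t" "0 < \<zeta> t" "0 < F t" using pos t by auto
    show "0 \<le> q t \<eta>" by (simp add: q_def)
    show "q t \<eta> \<le> 2 * (1 / \<zeta> t)"
    proof (cases "t \<in> H")
      case True
      then show ?thesis using HB(3)[OF True \<eta>] p by (auto simp: q_def intro!: divide_left_mono mult_pos_pos)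
    qed (use p in \<open>simp add: q_def\<close>)
    show "\<bar>b t \<eta>\<bar> \<le> 2 * \<Lambda> t" using HB(1)[of t \<eta>] \<eta> p by (auto simp: b_def abs_mult)
    show "\<bar>h t \<eta>\<bar> \<le> 2 * F t" using HB(2)[of t \<eta>] \<eta> p by (auto simp: h_def abs_mult)
  next
    show "(\<lambda>t. 2 * (1 / \<zeta> t)) absolutely_integrable_on {A..B}"
      by (intro set_integrable_lborel_imp_lebesgue set_integrable_mult_right assms)
    show "(\<lambda>t. 2 * \<Lambda> t) absolutely_integrable_on {A..B}"
      by (intro set_integrable_lborel_imp_lebesgue set_integrable_mult_right assms)
    show "(\<lambda>t. 2 * F t) absolutely_integrable_on {A..B}"
      by (intro set_integrable_lborel_imp_lebesgue set_integrable_mult_right assms)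
    \<comment> \<open>On \<open>H\<close> the quotient
      \<open>2 / (\<sigma> t \<eta>)\<^sup>2\<close> is nonzero, so zeros of \<open>q\<close> occur
      only in \<open>N\<close> or at an endpoint.\<close>
    show "negligible {t \<in> {A..B}. \<exists>\<eta>\<in>U. q t \<eta> = 0}"
    proof (rule negligible_subset)
      show "negligible (N \<union> {A, B})" using Nneg by simp
      show "{t \<in> {A..B}. \<exists>\<eta>\<in>U. q t \<eta> = 0} \<subseteq> N \<union> {A, B}"
      proof
        fix t assume "t \<in> {t \<in> {A..B}. \<exists>\<eta>\<in>U. q t \<eta> = 0}"
        then obtain \<eta> where t: "t \<in> {A..B}" "\<eta> \<in> U" "q t \<eta> = 0" by auto
        then have "t \<notin> H" using s0[of t] by (auto simp: q_def)
        then show "t \<in> N \<union> {A, B}" using t by (auto simp: H_def)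
      qed
    qed
  qed
  obtain \<alpha> v where v: "continuous_on {A..B} v"
    "\<And>x. x \<in> {A..B} \<Longrightarrow> v x = integral {A..x} (\<lambda>t. G \<alpha> t (v t))"
    "integral {A..B} v + P\<^sub>B = (LINT x|\<nu>\<^sub>B. integral {A..x} v)"
    using boundary_solution[OF assms(19,20)] by blast

  \<comment> \<open>Verification of regularity, equation and boundary conditions\<close>
  define g where "g t = G \<alpha> t (v t)" for t
  have g: "g absolutely_integrable_on {A..B}"
    unfolding g_def[abs_def] by (rule G_integrable[OF v(1)])
  have vg: "v x = integral {A..x} g" if "x \<in> {A..B}" for x
    using v(2)[OF that] by (simp add: g_def[abs_def])
  obtain N' where N': "negligible N'"
    "\<And>x. x \<in> {A<..<B} - N' \<Longrightarrow> ((\<lambda>x. integral {A..x} g) has_real_derivative g x) (at x)"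
    using indefinite_integral_has_derivative_ae[OF g] by blast
  define V where "V x = integral {A..x} v" for x
  have dV: "(V has_vector_derivative v x) (at x within {A..B})" if "x \<in> {A..B}" for x
    unfolding V_def[abs_def] by (rule integral_has_vector_derivative[OF v(1) that])
  have iV: "interval_deriv A B V x = v x" if "x \<in> {A..B}" for x
    unfolding interval_deriv_def
    by (rule vector_derivative_within_closed_interval[OF AB that dV[OF that]])
  have "V differentiable_on {A..B}"
    unfolding differentiable_on_def using dV differentiableI_vector by blast
  \<comment> \<open>The additive constant is \<open>0\<close>, because \<open>v\<close> is itself
    the integral of \<open>g\<close> from \<open>A\<close>.\<close>
  moreover have "abs_continuous_on_interval A B (interval_deriv A B V)"
    by (rule abs_continuous_on_interval_integral[OF g, of _ 0]) (simp only: iV vg add_0)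
  ultimately have W: "V \<in> W21 A B" by (simp add: W21_def)
  have eq: "interval_deriv A B V differentiable (at x) \<and>
          \<alpha> = (SUP \<eta>\<in>U. 1 / 2 * (\<sigma> x \<eta>)\<^sup>2 * interval_deriv A B (interval_deriv A B V) x
                     + \<mu> x \<eta> * interval_deriv A B V x + f x \<eta>)"
    if x: "x \<in> {A<..<B}" "x \<notin> N" "x \<notin> N'" for x
  proof -
    have xH: "x \<in> H" and xAB: "x \<in> {A..B}" using x by (auto simp: H_def)
    \<comment> \<open>This derivative is two-sided: on the open interval around \<open>x\<close> the
      function \<open>interval_deriv A B V\<close> agrees with the indefinite integral of
      \<open>g\<close>.\<close>
    have d: "(interval_deriv A B V has_real_derivative g x) (at x)"
    proof (rule has_field_derivative_transform_within_open)
      show "((\<lambda>x. integral {A..x} g) has_real_derivative g x) (at x)" using N'(2) x by auto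
      show "integral {A..y} g = interval_deriv A B V y" if "y \<in> {A<..<B}" for y
        using iV[of y] vg[of y] that by auto
    qed (use x in auto)
    then have "(interval_deriv A B V has_vector_derivative g x) (at x within {A..B})"
      by (simp add: has_real_derivative_iff_has_vector_derivative has_vector_derivative_at_within)
    then have dd: "interval_deriv A B (interval_deriv A B V) x = g x"
      unfolding interval_deriv_def[of A B "interval_deriv A B V"]
      by (rule vector_derivative_within_closed_interval[OF AB xAB])
    \<comment> \<open>On \<open>H\<close> the modified coefficients are the original ones, so
      \<open>g x\<close> is the infimum that \<open>eq_SUP_of_eq_INF\<close> converts into the
      supremum equation.\<close>
    have gx: "g x = (INF \<eta>\<in>U. \<alpha> * (2 / (\<sigma> x \<eta>)\<^sup>2) - 2 * \<mu> x \<eta> / (\<sigma> x \<eta>)\<^sup>2 * v x - 2 * f x \<eta> / (\<sigma> x \<eta>)\<^sup>2)"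
      using xH by (simp add: g_def G_def q_def b_def h_def)
    have "\<alpha> = (SUP \<eta>\<in>U. 1 / 2 * (\<sigma> x \<eta>)\<^sup>2 * g x + \<mu> x \<eta> * v x + f x \<eta>)"
      using spos cont_\<eta> xAB by (intro eq_SUP_of_eq_INF[OF assms(3,4) _ _ _ _ gx]) auto
    moreover have "interval_deriv A B V differentiable (at x)"
      using d by (auto simp: real_differentiable_def)
    ultimately show ?thesis using dd iV[OF xAB] by simp
  qed
  have "AE x in lborel. x \<notin> N" using N by (rule AE_not_in)
  \<comment> \<open>\<open>N'\<close> is only known to be null for the completed measure; the
    almost-everywhere statement nevertheless descends to \<open>lborel\<close>.\<close>
  moreover have "AE x in lborel. x \<notin> N'"
  proof -
    have "AE x in lebesgue. x \<notin> N'" using N'(1) by (intro AE_not_in) (simp add: negligible_iff_null_sets)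
    then show ?thesis by (simp add: AE_completion_iff)
  qed
  ultimately have "AE x in lborel. x \<in> {A<..<B} \<longrightarrow>
          interval_deriv A B V differentiable (at x) \<and>
          \<alpha> = (SUP \<eta>\<in>U. 1 / 2 * (\<sigma> x \<eta>)\<^sup>2 * interval_deriv A B (interval_deriv A B V) x
                     + \<mu> x \<eta> * interval_deriv A B V x + f x \<eta>)"
    by eventually_elim (use eq in blast)
  moreover have "V B + P\<^sub>B = (LINT x|\<nu>\<^sub>B. V x)" using v(3) by (simp add: V_def)
  moreover have "interval_deriv A B V A = 0" using iV[of A] vg[of A] AB by simp
  ultimately show ?thesis using W by blast
qed

end
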